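(* Let $f:\mathbb{N}\to\mathbb{N}$ with $f(n)>n$ and let $\alpha=\{\alpha_n\}_{n\in\mathbb{N}}$, $\beta=\{\beta_n\}_{n\in\mathbb{N}}$ be null sequences of non-negative real numbers. There exists a sequence of arithmetic algorithms $$\Gamma_n:\Omega_{f,\alpha,\beta}\times(\mathbb{C}\setminus\mathbb{R})\to l^2(\mathbb{N})$$ with the following properties: 1. For all $(T,x)\in\Omega_{f,\alpha,\beta}$ and $z\in\mathbb{C}\setminus\mathbb{R}$, $\Gamma_n(T,x,z)$ has finite support with respect to the canonical basis and converges to $R(z,T)x$ in $l^2(\mathbb{N})$ as $n\to\infty$. 2. For any $(T,x)\in\Omega_{f,\alpha,\beta}$ there exists a constant $C(T,x)$ such that for all $z\in\mathbb{C}\setminus\mathbb{R}$ (and all $n$), $$\|\Gamma_n(T,x,z)-R(z,T)x\|\le\frac{C(T,x)}{|\mathrm{Im}(z)|}\left[\alpha_n+\beta_n\right].$$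
   Context: $l^2(\mathbb{N})$ has canonical basis $\{e_n\}_{n\in\mathbb{N}}$ and $P_n$ is the orthogonal projection onto $\mathrm{span}\{e_1,\dots,e_n\}$. $\Omega_{\mathrm{SA}}$ is the set of (possibly unbounded) self-adjoint operators $T$ on $l^2(\mathbb{N})$ for which $\mathrm{span}\{e_n:n\in\mathbb{N}\}$ is a core. $R(z,T)=(T-zI)^{-1}$. Set $$\Omega_{f,\alpha,\beta}=\{T\in\Omega_{\mathrm{SA}}:\|(P_{f(n)}-I)TP_n\|=O(\alpha_n)\}\times\{x\in l^2(\mathbb{N}):\|P_nx-x\|=O(\beta_n)\},$$ where the $O$-constants may depend on $T$ or $x$; when $\alpha_n\equiv0$ one requires $\|(P_{f(n)}-I)TP_n\|=0$. A null sequence is a sequence converging to zero. The algorithms use the evaluation set $\Lambda_1=\{\langle Te_j,e_i\rangle:i,j\in\mathbb{N}\}$, extended by the evaluations of the coefficients of $x$ (and the input $z$). The function $f$ and the sequence $\alpha$ can also be considered as inputs to the algorithm. General and arithmetic algorithms: given a set $\Omega$ of inputs, a metric space $\mathcal{M}$ and a set $\Lambda$ of complex-valued evaluation functions on $\Omega$, a general algorithm is a map $\Gamma:\Omega\to\mathcal{M}$ such that for every $A\in\Omega$ there is a finite non-empty $\Lambda_\Gamma(A)\subset\Lambda$ for which $\Gamma(A)$ depends only on $\{g(A)\}_{g\in\Lambda_\Gamma(A)}$, and $\Lambda_\Gamma(B)=\Lambda_\Gamma(A)$ whenever $g(B)=g(A)$ for all $g\in\Lambda_\Gamma(A)$. A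 sequence of general algorithms $\Gamma_n$ is a sequence of arithmetic algorithms if, for each $A$, $n\mapsto\Gamma_n(A)$ is recursive (executable by a Turing machine with oracle access to the values $g(A)$ if these are rational, and by a Blum--Shub--Smale machine with such an oracle if they are real or complex), only finitely many arithmetic operations and comparisons on $\{g(A)\}_{g\in\Lambda_{\Gamma_n}(A)}$ are used, and the output is a finite string of complex numbers identified with an element of $\mathcal{M}$.
   Formalization: The error bound in part 2 is claimed only for those n with α_n+β_n>0 (otherwise it would force R(z,T)x to have finite support, false for the free Jacobi operator and x=e_1), and the algorithms may read the values β_n as well as f(n) and α_n. *)

theory Defs
  imports "HOL-Analysis.Analysis" "HOL-Library.Landau_Symbols"
begin

section \<open>The Hilbert space of square-summable sequences\<close>

text \<open>
  Coordinates are numbered from 0, so \<open>basis k\<close> is the mathematical $e_{k+1}$.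
  Sequences such as \<open>f\<close>, \<open>\<alpha>\<close>, \<open>\<beta>\<close> and the projections \<open>proj n\<close> keep their usual index
  \<open>n \<ge> 1\<close>; their value at index 0 is never constrained.
\<close>

typedef ell2 = "{x :: nat \<Rightarrow> complex. summable (\<lambda>k. (cmod (x k))\<^sup>2)}"
  morphisms coeff Abs_ell2
  by (rule exI[of _ "\<lambda>_. 0"]) simp

lemma ell2_eqI: "(\<And>k. coeff x k = coeff y k) \<Longrightarrow> x = y"
  by (metis coeff_inject ext)

lemma summable_coeff: "summable (\<lambda>k. (cmod (coeff x k))\<^sup>2)"
  using coeff[of x] by simp

lemma summable_coeff_mult: "summable (\<lambda>k. coeff x k * cnj (coeff y k))"
proof (rule summable_comparison_test)
  show "summable (\<lambda>k. (cmod (coeff x k))\<^sup>2 + (cmod (coeff y k))\<^sup>2)"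
    by (intro summable_add summable_coeff)
  have "a * b \<le> a\<^sup>2 + b\<^sup>2" if "a \<ge> 0" "b \<ge> 0" for a b :: real
    using sum_squares_bound[of a b] mult_nonneg_nonneg[OF that] by linarith
  then show "\<exists>N. \<forall>k\<ge>N. norm (coeff x k * cnj (coeff y k))
      \<le> (cmod (coeff x k))\<^sup>2 + (cmod (coeff y k))\<^sup>2"
    by (simp add: norm_mult)
qed

lemma summable_ell2_add:
  "summable (\<lambda>k. (cmod (coeff x k + coeff y k))\<^sup>2)"
proof (rule summable_comparison_test)
  show "summable (\<lambda>k. 2 * (cmod (coeff x k))\<^sup>2 + 2 * (cmod (coeff y k))\<^sup>2)"
    by (intro summable_add summable_mult summable_coeff)
  have "(cmod (a + b))\<^sup>2 \<le> 2 * (cmod a)\<^sup>2 + 2 * (cmod b)\<^sup>2" for a b :: complex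
  proof -
    have "(cmod (a + b))\<^sup>2 \<le> (cmod a + cmod b)\<^sup>2"
      by (intro power_mono norm_triangle_ineq) simp
    also have "\<dots> \<le> 2 * (cmod a)\<^sup>2 + 2 * (cmod b)\<^sup>2"
      using sum_squares_bound[of "cmod a" "cmod b"] by (simp add: power2_sum)
    finally show ?thesis .
  qed
  then show "\<exists>N. \<forall>k\<ge>N. norm ((cmod (coeff x k + coeff y k))\<^sup>2)
      \<le> 2 * (cmod (coeff x k))\<^sup>2 + 2 * (cmod (coeff y k))\<^sup>2"
    by simp
qed

definition scale_ell2 :: "complex \<Rightarrow> ell2 \<Rightarrow> ell2" (infixr "*\<^sub>C" 75)
  where "c *\<^sub>C x = Abs_ell2 (\<lambda>k. c * coeff x k)"

lemma coeff_scale [simp]: "coeff (c *\<^sub>C x) k = c * coeff x k"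
  unfolding scale_ell2_def using summable_mult[OF summable_coeff[of x], of "(cmod c)\<^sup>2"]
  by (subst Abs_ell2_inverse) (auto simp: norm_mult power_mult_distrib)

definition cinner :: "ell2 \<Rightarrow> ell2 \<Rightarrow> complex"
  where "cinner x y = (\<Sum>k. coeff x k * cnj (coeff y k))"

instantiation ell2 :: real_vector
begin

definition zero_ell2 :: ell2 where "0 = Abs_ell2 (\<lambda>_. 0)"
definition plus_ell2 :: "ell2 \<Rightarrow> ell2 \<Rightarrow> ell2"
  where "x + (y :: ell2) = Abs_ell2 (\<lambda>k. coeff x k + coeff y k)"
definition uminus_ell2 :: "ell2 \<Rightarrow> ell2" where "- (x :: ell2) = (- 1) *\<^sub>C x"
definition minus_ell2 :: "ell2 \<Rightarrow> ell2 \<Rightarrow> ell2" where "x - (y :: ell2) = x + - y"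
definition scaleR_ell2 :: "real \<Rightarrow> ell2 \<Rightarrow> ell2"
  where "r *\<^sub>R (x :: ell2) = complex_of_real r *\<^sub>C x"

lemma coeff_zero [simp]: "coeff 0 k = 0"
  by (simp add: zero_ell2_def Abs_ell2_inverse)

lemma coeff_plus [simp]: "coeff (x + y) k = coeff x k + coeff y k"
  using summable_ell2_add[of x y] by (simp add: plus_ell2_def Abs_ell2_inverse)

instance
  by standard
    (auto intro!: ell2_eqI simp: uminus_ell2_def minus_ell2_def scaleR_ell2_def algebra_simps)

end

instantiation ell2 :: real_inner
begin

definition inner_ell2 :: "ell2 \<Rightarrow> ell2 \<Rightarrow> real" where "inner x y = Re (cinner x y)"
definition norm_ell2 :: "ell2 \<Rightarrow> real" where "norm (x :: ell2) = sqrt (inner x x)"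
definition sgn_ell2 :: "ell2 \<Rightarrow> ell2" where "sgn (x :: ell2) = x /\<^sub>R norm x"
definition dist_ell2 :: "ell2 \<Rightarrow> ell2 \<Rightarrow> real" where "dist x (y :: ell2) = norm (x - y)"
definition uniformity_ell2 :: "(ell2 \<times> ell2) filter"
  where "uniformity_ell2 = (INF e\<in>{0<..}. principal {(x, y). dist x y < e})"
definition open_ell2 :: "ell2 set \<Rightarrow> bool"
  where "open (U :: ell2 set) \<longleftrightarrow> (\<forall>x\<in>U. \<forall>\<^sub>F (x', y) in uniformity. x' = x \<longrightarrow> y \<in> U)"

instance
proof
  fix x y w :: ell2 and r :: real
  show "dist x y = norm (x - y)" "sgn x = x /\<^sub>R norm x" "norm x = sqrt (inner x x)"
    by (simp_all add: dist_ell2_def sgn_ell2_def norm_ell2_def)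
  show "uniformity = (INF e\<in>{0<..}. principal {(x :: ell2, y). dist x y < e})"
    by (rule uniformity_ell2_def)
  show "open U = (\<forall>x\<in>U. \<forall>\<^sub>F (x', y) in uniformity. x' = x \<longrightarrow> y \<in> U)" for U :: "ell2 set"
    by (rule open_ell2_def)
  have inner: "inner u v = (\<Sum>k. Re (coeff u k * cnj (coeff v k)))" for u v :: ell2
    unfolding inner_ell2_def cinner_def by (rule Re_suminf[OF summable_coeff_mult])
  have sm: "summable (\<lambda>k. Re (coeff u k * cnj (coeff v k)))" for u v :: ell2
    by (rule summable_Re[OF summable_coeff_mult])
  have sq: "Re (coeff x k * cnj (coeff x k)) = (cmod (coeff x k))\<^sup>2" for k
    by (simp flip: complex_norm_square)
  show "inner x y = inner y x"
    by (simp add: inner mult.commute)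
  show "inner (x + y) w = inner x w + inner y w"
    unfolding inner suminf_add[OF sm sm] by (simp add: algebra_simps)
  show "inner (r *\<^sub>R x) y = r * inner x y"
    unfolding inner suminf_mult[OF sm, symmetric] scaleR_ell2_def by (simp add: algebra_simps)
  show "0 \<le> inner x x"
    unfolding inner sq by (intro suminf_nonneg summable_coeff) simp
  show "inner x x = 0 \<longleftrightarrow> x = 0"
    unfolding inner sq
    by (subst suminf_eq_zero_iff[OF summable_coeff]) (auto intro: ell2_eqI)
qed

end

interpretation ell2: vector_space "(*\<^sub>C)"
  by unfold_locales (auto intro!: ell2_eqI simp: algebra_simps)

definition basis :: "nat \<Rightarrow> ell2"
  where "basis k = Abs_ell2 (\<lambda>l. if l = k then 1 else 0)"

definition proj :: "nat \<Rightarrow> ell2 \<Rightarrow> ell2"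
  where "proj n x = (\<Sum>k<n. cinner x (basis k) *\<^sub>C basis k)"


section \<open>Unbounded self-adjoint operators\<close>

text \<open>An operator with domain \<open>dom T\<close> is a partial map.\<close>

type_synonym operator = "ell2 \<rightharpoonup> ell2"

definition linear_operator :: "operator \<Rightarrow> bool" where
  "linear_operator T \<longleftrightarrow> ell2.subspace (dom T) \<and>
     (\<forall>x\<in>dom T. \<forall>y\<in>dom T. the (T (x + y)) = the (T x) + the (T y)) \<and>
     (\<forall>c. \<forall>x\<in>dom T. the (T (c *\<^sub>C x)) = c *\<^sub>C the (T x))"

definition adjoint_operator :: "operator \<Rightarrow> operator" where
  "adjoint_operator T = (\<lambda>y.
     if \<exists>w. \<forall>x\<in>dom T. cinner (the (T x)) y = cinner x w
     then Some (THE w. \<forall>x\<in>dom T. cinner (the (T x)) y = cinner x w)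
     else None)"

definition self_adjoint :: "operator \<Rightarrow> bool" where
  "self_adjoint T \<longleftrightarrow>
     linear_operator T \<and> closure (dom T) = UNIV \<and> adjoint_operator T = T"

definition is_core :: "ell2 set \<Rightarrow> operator \<Rightarrow> bool" where
  "is_core D T \<longleftrightarrow> ell2.subspace D \<and> D \<subseteq> dom T \<and>
     closure (Map.graph (T |` D)) = Map.graph T"

definition Omega_SA :: "operator set" where
  "Omega_SA = {T. self_adjoint T \<and> is_core (ell2.span (range basis)) T}"

definition resolvent :: "complex \<Rightarrow> operator \<Rightarrow> ell2 \<Rightarrow> ell2" where
  "resolvent z T = inv_into (dom T) (\<lambda>y. the (T y) - z *\<^sub>C y)"

definition off_norm :: "(nat \<Rightarrow> nat) \<Rightarrow> operator \<Rightarrow> nat \<Rightarrow> real" where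
  "off_norm f T n = onorm (\<lambda>x. proj (f n) (the (T (proj n x))) - the (T (proj n x)))"

definition Omega :: "(nat \<Rightarrow> nat) \<Rightarrow> (nat \<Rightarrow> real) \<Rightarrow> (nat \<Rightarrow> real) \<Rightarrow> (operator \<times> ell2) set" where
  "Omega f \<alpha> \<beta> =
     {T \<in> Omega_SA. off_norm f T \<in> O(\<alpha>) \<and>
        ((\<forall>n\<ge>1. \<alpha> n = 0) \<longrightarrow> (\<forall>n\<ge>1. off_norm f T n = 0))} \<times>
     {x. (\<lambda>n. norm (proj n x - x)) \<in> O(\<beta>)}"


section \<open>General algorithms\<close>

definition general_algorithm ::
  "'a set \<Rightarrow> ('a \<Rightarrow> complex) set \<Rightarrow> ('a \<Rightarrow> 'm :: metric_space) \<Rightarrow> ('a \<Rightarrow> ('a \<Rightarrow> complex) set) \<Rightarrow> bool"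
where
  "general_algorithm \<Omega> \<Lambda> \<Gamma> \<Lambda>\<Gamma> \<longleftrightarrow> (\<forall>A\<in>\<Omega>.
     finite (\<Lambda>\<Gamma> A) \<and> \<Lambda>\<Gamma> A \<noteq> {} \<and> \<Lambda>\<Gamma> A \<subseteq> \<Lambda> \<and>
     (\<forall>B\<in>\<Omega>. (\<forall>g\<in>\<Lambda>\<Gamma> A. g B = g A) \<longrightarrow> \<Gamma> B = \<Gamma> A \<and> \<Lambda>\<Gamma> B = \<Lambda>\<Gamma> A))"


section \<open>Blum--Shub--Smale machines over the reals with an oracle\<close>

text \<open>
  The machine model is that of Blum, Shub and Smale: a finite flowchart whose state consists of the
  current node, two natural-number address registers and a memory with infinitely many real cells.
  A computation node applies a rational function (of finitely many fixed cells); a branch node tests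
  the sign of one; an address register can be incremented or reset; a copy node moves the cell at
  the first address to the cell at the second address. Added to these is the oracle node, which
  asks for the complex number named by a symbol and the two addresses and stores its real and
  imaginary part. A rational function is written as an expression, and a division by zero yields 0.

  The machine constants are rational. Hence on rational oracle values a run is a finite computation
  with exact rational arithmetic, which a Turing machine with the same oracle can carry out, and one
  program serves both the Turing and the Blum--Shub--Smale clause in the definition of recursiveness.
\<close>

datatype rational_function =
    Const rat
  | Cell nat
  | Plus rational_function rational_function
  | Minus rational_function rational_function
  | Times rational_function rational_function
  | Divide rational_function rational_function

primrec rf_value :: "rational_function \<Rightarrow> (nat \<Rightarrow> real) \<Rightarrow> real" where
  "rf_value (Const c) m = of_rat c"
| "rf_value (Cell k) m = m k"
| "rf_value (Plus s t) m = rf_value s m + rf_value t m"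
| "rf_value (Minus s t) m = rf_value s m - rf_value t m"
| "rf_value (Times s t) m = rf_value s m * rf_value t m"
| "rf_value (Divide s t) m = rf_value s m / rf_value t m"

text \<open>
  Control passes from node \<open>l\<close> of the list to node \<open>l + 1\<close>, except that \<open>Branch h l'\<close> passes to
  \<open>l'\<close> if \<open>h\<close> is nonnegative. The machine halts on leaving the list.
\<close>

datatype 'q bss_node =
    Compute nat rational_function
  | Branch rational_function nat
  | Incr1 | Reset1 | Incr2 | Reset2
  | Copy
  | Query 'q nat nat

record bss_state =
  label :: nat
  addr1 :: nat
  addr2 :: nat
  mem :: "nat \<Rightarrow> real"

type_synonym 'q oracle_function = "'q \<Rightarrow> nat \<Rightarrow> nat \<Rightarrow> complex"

primrec bss_exec :: "'q oracle_function \<Rightarrow> 'q bss_node \<Rightarrow> bss_state \<Rightarrow> bss_state" where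
  "bss_exec orc (Compute k h) s =
     s\<lparr>label := label s + 1, mem := (mem s)(k := rf_value h (mem s))\<rparr>"
| "bss_exec orc (Branch h l) s =
     s\<lparr>label := (if rf_value h (mem s) \<ge> 0 then l else label s + 1)\<rparr>"
| "bss_exec orc Incr1 s = s\<lparr>label := label s + 1, addr1 := addr1 s + 1\<rparr>"
| "bss_exec orc Reset1 s = s\<lparr>label := label s + 1, addr1 := 0\<rparr>"
| "bss_exec orc Incr2 s = s\<lparr>label := label s + 1, addr2 := addr2 s + 1\<rparr>"
| "bss_exec orc Reset2 s = s\<lparr>label := label s + 1, addr2 := 0\<rparr>"
| "bss_exec orc Copy s =
     s\<lparr>label := label s + 1, mem := (mem s)(addr2 s := mem s (addr1 s))\<rparr>"
| "bss_exec orc (Query q k l) s =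
     s\<lparr>label := label s + 1,
       mem := (mem s)(k := Re (orc q (addr1 s) (addr2 s)), l := Im (orc q (addr1 s) (addr2 s)))\<rparr>"

definition bss_step :: "'q bss_node list \<Rightarrow> 'q oracle_function \<Rightarrow> bss_state \<Rightarrow> bss_state" where
  "bss_step P orc s = (if label s < length P then bss_exec orc (P ! label s) s else s)"

definition bss_init :: "nat \<Rightarrow> bss_state" where
  "bss_init n = \<lparr>label = 0, addr1 = 0, addr2 = 0, mem = (\<lambda>_. 0)(0 := real n)\<rparr>"

definition bss_run :: "'q bss_node list \<Rightarrow> 'q oracle_function \<Rightarrow> nat \<Rightarrow> nat \<Rightarrow> bss_state" where
  "bss_run P orc n t = (bss_step P orc ^^ t) (bss_init n)"

text \<open>
  On halting, the first address register points to the output, the second holds its length; each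
  complex number takes two cells.
\<close>

definition bss_output :: "bss_state \<Rightarrow> complex list" where
  "bss_output s = map (\<lambda>l. Complex (mem s (addr1 s + 2 * l)) (mem s (addr1 s + 2 * l + 1)))
                    [0..<addr2 s]"

definition bss_computes :: "'q bss_node list \<Rightarrow> 'q oracle_function \<Rightarrow> nat \<Rightarrow> complex list \<Rightarrow> bool" where
  "bss_computes P orc n out \<longleftrightarrow>
     (\<exists>t. label (bss_run P orc n t) \<ge> length P \<and> bss_output (bss_run P orc n t) = out)"

definition bss_queries :: "'q bss_node list \<Rightarrow> 'q oracle_function \<Rightarrow> nat \<Rightarrow> ('q \<times> nat \<times> nat) set" where
  "bss_queries P orc n =
     {(q, addr1 (bss_run P orc n t), addr2 (bss_run P orc n t)) | q k l t.
        label (bss_run P orc n t) < length P \<and> P ! label (bss_run P orc n t) = Query q k l}"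


section \<open>Arithmetic algorithms\<close>

text \<open>
  The evaluation functions are given as a family \<open>ev\<close>, indexed by what the oracle node can ask for;
  \<open>dec\<close> identifies finite strings with elements of the metric space. One program, receiving \<open>n\<close>
  as its input, serves all \<open>n\<close> and all \<open>A\<close>, and on \<open>A\<close> it asks only for values in \<open>\<Lambda>\<Gamma> n A\<close>.
\<close>

definition arithmetic_algorithms ::
  "'a set \<Rightarrow> ('q \<Rightarrow> nat \<Rightarrow> nat \<Rightarrow> 'a \<Rightarrow> complex) \<Rightarrow> (complex list \<Rightarrow> 'm :: metric_space) \<Rightarrow>
   (nat \<Rightarrow> 'a \<Rightarrow> 'm) \<Rightarrow> bool"
where
  "arithmetic_algorithms \<Omega> ev dec \<Gamma> \<longleftrightarrow> (\<exists>\<Lambda>\<Gamma> P. \<forall>n\<ge>1.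
     general_algorithm \<Omega> {ev q i j | q i j. True} (\<Gamma> n) (\<Lambda>\<Gamma> n) \<and>
     (\<forall>A\<in>\<Omega>. (\<exists>out. bss_computes P (\<lambda>q i j. ev q i j A) n out \<and> \<Gamma> n A = dec out) \<and>
        (\<forall>(q, i, j) \<in> bss_queries P (\<lambda>q i j. ev q i j A) n. ev q i j \<in> \<Lambda>\<Gamma> n A)))"

definition finite_vector :: "complex list \<Rightarrow> ell2" where
  "finite_vector cs = (\<Sum>k<length cs. cs ! k *\<^sub>C basis k)"

text \<open>
  Besides the matrix entries, the coefficients of \<open>x\<close> and \<open>z\<close>, the algorithms may read the data
  \<open>f\<close>, \<open>\<alpha>\<close>, \<open>\<beta>\<close> of the problem class, as evaluation functions that are constant on the class.
\<close>

datatype query = Entry | Coefficient | Point | F_value | Alpha_value | Beta_value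

fun evaluation :: "(nat \<Rightarrow> nat) \<Rightarrow> (nat \<Rightarrow> real) \<Rightarrow> (nat \<Rightarrow> real) \<Rightarrow>
  query \<Rightarrow> nat \<Rightarrow> nat \<Rightarrow> (operator \<times> ell2) \<times> complex \<Rightarrow> complex"
where
  "evaluation f \<alpha> \<beta> Entry i j ((T, x), z) = cinner (the (T (basis j))) (basis i)"
| "evaluation f \<alpha> \<beta> Coefficient i j ((T, x), z) = cinner x (basis i)"
| "evaluation f \<alpha> \<beta> Point i j ((T, x), z) = z"
| "evaluation f \<alpha> \<beta> F_value i j ((T, x), z) = of_nat (f i)"
| "evaluation f \<alpha> \<beta> Alpha_value i j ((T, x), z) = of_real (\<alpha> i)"
| "evaluation f \<alpha> \<beta> Beta_value i j ((T, x), z) = of_real (\<beta> i)"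

end

theory Submission
  imports Defs
begin

text \<open>
  For non-real \<open>z\<close> the operator \<open>T - z\<close> is onto and expands norms by at least \<open>\<bar>Im z\<bar>\<close>, so a vector \<open>y\<close>
  misses the solution \<open>R(z,T)x\<close> by at most \<open>\<parallel>(T - z)y - x\<parallel> / \<bar>Im z\<bar>\<close> (\<open>resolvent_error_le\<close>). It does not
  matter how \<open>y\<close> was found: the algorithm enumerates finitely supported vectors and stops at the first
  one whose residual is certified to be small.

  The certificate is a finite computation. For \<open>y\<close> in the range of \<open>P\<^sub>k\<close> the part of the residual in the
  range of \<open>P\<close> with index \<open>f k\<close> is a finite sum of matrix entries, and the rest has norm at most
  \<open>off_norm f T k * \<parallel>y\<parallel> + \<parallel>P\<^sub>k x - x\<parallel>\<close>, which is at most a constant times \<open>\<alpha> k * \<parallel>y\<parallel> + \<beta> k\<close> once \<open>k\<close> is large. The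
  \<open>defect\<close> of the candidate with number \<open>k\<close> is the sum of the squares of the computable part, of
  \<open>\<alpha> k * \<parallel>y\<parallel>\<close> and of \<open>\<beta> k\<close>, together with \<open>\<parallel>y\<parallel>\<^sup>2 / k\<close>. The last summand makes the constant uniform in
  \<open>z\<close>: for the finitely many \<open>k\<close> at which the asymptotic bounds may fail, it keeps \<open>\<parallel>y\<parallel>\<close> below a multiple
  of the tolerance (\<open>residual_le_tolerance\<close>). The tolerance for the input \<open>n\<close> is \<open>\<alpha> n + \<beta> n\<close>, replaced by
  \<open>1 / n\<close> where that sum vanishes, so it is positive and tends to 0.

  The search, which starts at \<open>k = n\<close>, ends because the finitely supported vectors form a core. Hence
  \<open>T - z\<close> maps them onto a dense set (\<open>core_dense_range\<close>), and some candidate \<open>y\<close> has residual below the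
  tolerance. Every candidate has infinitely many numbers (\<open>candidates_dense\<close>), so \<open>k\<close> can grow with \<open>y\<close>
  fixed, and then all summands of the defect but the residual tend to 0 (\<open>ex_small_defect\<close>).

  The search is written in a small structured language, compiled to machine nodes
  (\<open>compile_correct\<close>) and verified by a weakest-precondition calculus (\<open>machine_correct\<close>). That the
  machine yields general algorithms holds for every halting machine: a run depends only on the
  answers to the questions it asks (\<open>arithmetic_algorithmsI\<close>).
\<close>

section \<open>The Hilbert space\<close>

lemma coeff_basis [simp]: "coeff (basis k) l = (if l = k then 1 else 0)"
proof -
  have "summable (\<lambda>l. (cmod (if l = k then 1 else 0))\<^sup>2)"
    by (rule summable_finite[of "{k}"]) auto
  then show ?thesis
    by (simp add: basis_def Abs_ell2_inverse)
qed

lemma coeff_uminus [simp]: "coeff (- x) k = - coeff x k"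
  by (simp only: uminus_ell2_def coeff_scale) simp

lemma coeff_minus [simp]: "coeff (x - y) k = coeff x k - coeff y k"
  by (simp only: minus_ell2_def coeff_plus coeff_uminus) simp

lemma coeff_scaleR [simp]: "coeff (r *\<^sub>R x) k = complex_of_real r * coeff x k"
  by (simp add: scaleR_ell2_def)

lemma coeff_sum [simp]: "coeff (sum g S) k = (\<Sum>i\<in>S. coeff (g i) k)"
  by (induction S rule: infinite_finite_induct) auto

lemma cinner_basis [simp]: "cinner x (basis k) = coeff x k"
proof -
  have "(\<lambda>l. coeff x l * cnj (coeff (basis k) l)) = (\<lambda>l. if l = k then coeff x l else 0)"
    by auto
  then have "(\<lambda>l. coeff x l * cnj (coeff (basis k) l)) sums coeff x k"
    using sums_single[of k "coeff x"] by simp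
  then show ?thesis by (simp add: cinner_def sums_iff)
qed

lemma coeff_proj [simp]: "coeff (proj n x) k = (if k < n then coeff x k else 0)"
proof -
  have "coeff (proj n x) k = (\<Sum>i<n. if i = k then coeff x i else 0)"
    unfolding proj_def coeff_sum by (rule sum.cong) auto
  then show ?thesis by simp
qed

lemma norm_ell2_squared: "(norm x)\<^sup>2 = (\<Sum>k. (cmod (coeff x k))\<^sup>2)" for x :: ell2
proof -
  have "(norm x)\<^sup>2 = Re (\<Sum>k. coeff x k * cnj (coeff x k))"
    by (simp add: power2_norm_eq_inner inner_ell2_def cinner_def)
  also have "\<dots> = (\<Sum>k. Re (coeff x k * cnj (coeff x k)))"
    by (rule Re_suminf[OF summable_coeff_mult])
  finally show ?thesis by (simp flip: complex_norm_square)
qed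

lemma norm_ell2_mono:
  fixes x y :: ell2
  assumes "\<And>k. cmod (coeff x k) \<le> cmod (coeff y k)"
  shows "norm x \<le> norm y"
proof -
  have "(norm x)\<^sup>2 \<le> (norm y)\<^sup>2"
    unfolding norm_ell2_squared
    by (intro suminf_le summable_coeff power_mono assms) auto
  then show ?thesis by (rule power2_le_imp_le) simp
qed

lemma norm_scale [simp]: "norm (c *\<^sub>C x) = cmod c * norm x"
proof -
  have "(norm (c *\<^sub>C x))\<^sup>2 = (cmod c * norm x)\<^sup>2"
    by (simp add: norm_ell2_squared norm_mult power_mult_distrib suminf_mult[OF summable_coeff])
  then show ?thesis by (simp add: power2_eq_iff_nonneg)
qed

lemma norm_finite_ell2:
  assumes "\<And>k. k \<ge> N \<Longrightarrow> coeff x k = 0"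
  shows "(norm x)\<^sup>2 = (\<Sum>k<N. (cmod (coeff x k))\<^sup>2)"
  unfolding norm_ell2_squared
  by (rule suminf_finite) (auto simp: assms not_less)

lemma norm_proj_squared: "(norm (proj N x))\<^sup>2 = (\<Sum>k<N. (cmod (coeff x k))\<^sup>2)"
  by (subst norm_finite_ell2[of N]) auto

lemma norm_proj_le: "norm (proj N x) \<le> norm x"
  by (rule norm_ell2_mono) auto

lemma norm_proj_tail_antimono: "k \<le> N \<Longrightarrow> norm (proj N x - x) \<le> norm (proj k x - x)"
  by (rule norm_ell2_mono) auto

lemma cmod_coeff_le: "cmod (coeff x k) \<le> norm x"
proof -
  have "norm (coeff x k *\<^sub>C basis k) \<le> norm x"
    by (rule norm_ell2_mono) auto
  moreover have "(norm (basis k))\<^sup>2 = 1"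
    by (subst norm_finite_ell2[of "Suc k"]) auto
  then have "norm (basis k) = 1"
    using norm_ge_zero[of "basis k"] by (auto simp: power2_eq_1_iff simp del: norm_ge_zero)
  ultimately show ?thesis by simp
qed

lemma coeff_finite_vector [simp]:
  "coeff (finite_vector cs) i = (if i < length cs then cs ! i else 0)"
proof -
  have "coeff (finite_vector cs) i = (\<Sum>k<length cs. if k = i then cs ! k else 0)"
    unfolding finite_vector_def coeff_sum by (rule sum.cong) auto
  then show ?thesis by simp
qed

text \<open>
  Completeness is what makes the resolvent exist: the coordinatewise limit of a Cauchy sequence is
  square summable, because the finite sections of the differences stay uniformly small.
\<close>

lemma Cauchy_ell2_convergent:
  fixes X :: "nat \<Rightarrow> ell2"
  assumes "Cauchy X"
  shows "convergent X"
proof -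
  have "Cauchy (\<lambda>n. coeff (X n) k)" for k
  proof (rule CauchyI)
    fix e :: real assume "e > 0"
    then obtain M where M: "\<And>i j. i \<ge> M \<Longrightarrow> j \<ge> M \<Longrightarrow> norm (X i - X j) < e"
      using CauchyD[OF assms] by blast
    have "norm (coeff (X i) k - coeff (X j) k) < e" if "i \<ge> M" "j \<ge> M" for i j
      using cmod_coeff_le[of "X i - X j" k] M[OF that] by simp
    then show "\<exists>M. \<forall>i\<ge>M. \<forall>j\<ge>M. norm (coeff (X i) k - coeff (X j) k) < e" by blast
  qed
  then have "\<forall>k. \<exists>c. (\<lambda>n. coeff (X n) k) \<longlonglongrightarrow> c"
    by (simp add: Cauchy_convergent_iff convergent_def)
  then obtain c where c: "\<And>k. (\<lambda>n. coeff (X n) k) \<longlonglongrightarrow> c k"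
    by metis
  have partial_sums: "\<exists>M. \<forall>n\<ge>M. \<forall>L. (\<Sum>k<L. (cmod (coeff (X n) k - c k))\<^sup>2) \<le> e\<^sup>2" if "e > 0" for e
  proof -
    obtain M where M: "\<And>i j. i \<ge> M \<Longrightarrow> j \<ge> M \<Longrightarrow> norm (X i - X j) < e"
      using CauchyD[OF assms \<open>e > 0\<close>] by blast
    have "(\<Sum>k<L. (cmod (coeff (X n) k - c k))\<^sup>2) \<le> e\<^sup>2" if "n \<ge> M" for n L
    proof (rule LIMSEQ_le_const2)
      show "(\<lambda>i. \<Sum>k<L. (cmod (coeff (X n) k - coeff (X i) k))\<^sup>2)
              \<longlonglongrightarrow> (\<Sum>k<L. (cmod (coeff (X n) k - c k))\<^sup>2)"
        by (intro tendsto_intros c)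
      have "(\<Sum>k<L. (cmod (coeff (X n) k - coeff (X i) k))\<^sup>2) \<le> e\<^sup>2" if "i \<ge> M" for i
      proof -
        have "(\<Sum>k<L. (cmod (coeff (X n) k - coeff (X i) k))\<^sup>2) = (norm (proj L (X n - X i)))\<^sup>2"
          by (simp add: norm_proj_squared)
        also have "\<dots> \<le> e\<^sup>2"
          using norm_proj_le[of L "X n - X i"] M[OF \<open>n \<ge> M\<close> that] by (intro power_mono) auto
        finally show ?thesis .
      qed
      then show "\<exists>N. \<forall>i\<ge>N. (\<Sum>k<L. (cmod (coeff (X n) k - coeff (X i) k))\<^sup>2) \<le> e\<^sup>2" by blast
    qed
    then show ?thesis by blast
  qed
  obtain M where M: "\<And>L. (\<Sum>k<L. (cmod (coeff (X M) k - c k))\<^sup>2) \<le> 1"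
    using partial_sums[of 1] by auto
  have "summable (\<lambda>k. (cmod (coeff (X M) k - c k))\<^sup>2)"
    by (rule summableI_nonneg_bounded[of _ 1]) (use M in auto)
  then have d: "coeff (Abs_ell2 (\<lambda>k. coeff (X M) k - c k)) k = coeff (X M) k - c k" for k
    by (simp add: Abs_ell2_inverse)
  define Y where "Y = X M - Abs_ell2 (\<lambda>k. coeff (X M) k - c k)"
  have Y: "coeff Y k = c k" for k by (simp add: Y_def d)
  have "X \<longlonglongrightarrow> Y"
  proof (rule LIMSEQ_I)
    fix r :: real assume "r > 0"
    then obtain M' where M': "\<And>n L. n \<ge> M' \<Longrightarrow> (\<Sum>k<L. (cmod (coeff (X n) k - c k))\<^sup>2) \<le> (r / 2)\<^sup>2"
      using partial_sums[of "r / 2"] by auto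
    have "norm (X n - Y) < r" if "n \<ge> M'" for n
    proof -
      have "(norm (X n - Y))\<^sup>2 \<le> (r / 2)\<^sup>2"
        unfolding norm_ell2_squared
        by (rule suminf_le_const[OF summable_coeff]) (use M'[OF that] in \<open>simp add: Y\<close>)
      then have "norm (X n - Y) \<le> r / 2"
        by (rule power2_le_imp_le) (use \<open>r > 0\<close> in simp)
      then show ?thesis using \<open>r > 0\<close> by simp
    qed
    then show "\<exists>no. \<forall>n\<ge>no. norm (X n - Y) < r" by blast
  qed
  then show ?thesis by (auto simp: convergent_def)
qed

lemma cinner_eq_Complex: "cinner x y = Complex (inner x y) (inner x (\<i> *\<^sub>C y))"
proof -
  have "cinner x (\<i> *\<^sub>C y) = (\<Sum>k. - \<i> * (coeff x k * cnj (coeff y k)))"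
    by (simp add: cinner_def algebra_simps)
  also have "\<dots> = - \<i> * cinner x y"
    unfolding cinner_def by (rule suminf_mult[OF summable_coeff_mult])
  finally show ?thesis by (simp add: complex_eq_iff inner_ell2_def)
qed

lemma scale_diff: "c *\<^sub>C (x - y) = c *\<^sub>C x - c *\<^sub>C y"
  by (rule ell2_eqI) (simp add: algebra_simps)

lemma bounded_linear_scale: "bounded_linear (\<lambda>x. c *\<^sub>C x)"
  by (rule bounded_linear_intro[of _ "cmod c"])
    (auto intro!: ell2_eqI simp: algebra_simps)

lemma tendsto_scale [tendsto_intros]: "(g \<longlongrightarrow> y) F \<Longrightarrow> ((\<lambda>t. c *\<^sub>C g t) \<longlongrightarrow> c *\<^sub>C y) F"
  by (rule bounded_linear.tendsto[OF bounded_linear_scale])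

lemma tendsto_cinner [tendsto_intros]:
  assumes "(g \<longlongrightarrow> y) F"
  shows "((\<lambda>t. cinner x (g t)) \<longlongrightarrow> cinner x y) F"
  unfolding cinner_eq_Complex by (intro tendsto_intros assms)

lemma cinner_diff_left: "cinner (x - y) w = cinner x w - cinner y w"
  by (simp add: cinner_eq_Complex inner_diff_left complex_eq_iff)

lemma cinner_diff_right: "cinner w (x - y) = cinner w x - cinner w y"
  by (simp add: cinner_eq_Complex scale_diff inner_diff_right complex_eq_iff)

lemma cinner_scale_left: "cinner (c *\<^sub>C x) y = c * cinner x y"
  by (simp add: cinner_def mult.assoc suminf_mult[OF summable_coeff_mult])

lemma cinner_scale_right: "cinner x (c *\<^sub>C y) = cnj c * cinner x y"
proof -
  have "cinner x (c *\<^sub>C y) = (\<Sum>k. cnj c * (coeff x k * cnj (coeff y k)))"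
    by (simp add: cinner_def algebra_simps)
  also have "\<dots> = cnj c * cinner x y"
    unfolding cinner_def by (rule suminf_mult[OF summable_coeff_mult])
  finally show ?thesis .
qed

lemma cinner_commute: "cinner y x = cnj (cinner x y)"
proof -
  have "cnj (cinner x y) = (\<Sum>k. cnj (coeff x k * cnj (coeff y k)))"
    unfolding cinner_def
    by (rule bounded_linear.suminf[OF bounded_linear_cnj summable_coeff_mult])
  then show ?thesis by (simp add: cinner_def mult.commute)
qed

lemma cinner_self: "cinner x x = of_real ((norm x)\<^sup>2)"
proof -
  have "Im (cinner x x) = 0"
    using cinner_commute[of x x] by (simp add: complex_eq_iff)
  then show ?thesis
    by (simp add: complex_eq_iff power2_norm_eq_inner inner_ell2_def)
qed

lemma eq_if_dense_cinner_eq: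
  assumes dense: "closure D = UNIV" and eq: "\<And>x. x \<in> D \<Longrightarrow> cinner x v = cinner x w"
  shows "v = w"
proof -
  have "closed {x. inner x (v - w) = 0}"
    by (intro closed_Collect_eq continuous_intros)
  moreover have "D \<subseteq> {x. inner x (v - w) = 0}"
    using eq by (auto simp: inner_ell2_def cinner_diff_right)
  ultimately have "closure D \<subseteq> {x. inner x (v - w) = 0}"
    by (intro closure_minimal)
  then have "inner (v - w) (v - w) = 0"
    unfolding dense by blast
  then show ?thesis by simp
qed

section \<open>Self-adjoint operators and their resolvents\<close>

text \<open>
  Membership in the domain of a self-adjoint operator is tested by duality. The description in the
  adjoint is proper because the domain is dense.
\<close>

lemma self_adjoint_memI:
  assumes sa: "self_adjoint T" and w: "\<And>x. x \<in> dom T \<Longrightarrow> cinner (the (T x)) y = cinner x w"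
  shows "T y = Some w"
proof -
  have dense: "closure (dom T) = UNIV" and adj: "adjoint_operator T = T"
    using sa by (auto simp: self_adjoint_def)
  have "(THE w. \<forall>x\<in>dom T. cinner (the (T x)) y = cinner x w) = w"
  proof (rule the_equality)
    show "w' = w" if "\<forall>x\<in>dom T. cinner (the (T x)) y = cinner x w'" for w'
      by (rule eq_if_dense_cinner_eq[OF dense]) (use that w in metis)
  qed (use w in blast)
  moreover have "\<exists>w. \<forall>x\<in>dom T. cinner (the (T x)) y = cinner x w"
    using w by blast
  ultimately have "adjoint_operator T y = Some w"
    by (simp add: adjoint_operator_def)
  then show ?thesis by (simp add: adj)
qed

lemma self_adjoint_symmetric:
  assumes sa: "self_adjoint T" and "x \<in> dom T" "y \<in> dom T"
  shows "cinner (the (T x)) y = cinner x (the (T y))"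
proof -
  have "adjoint_operator T y = T y"
    using sa by (simp add: self_adjoint_def)
  with \<open>y \<in> dom T\<close> have "\<exists>w. \<forall>x\<in>dom T. cinner (the (T x)) y = cinner x w"
    by (auto simp: adjoint_operator_def split: if_splits)
  then obtain w where w: "\<And>x. x \<in> dom T \<Longrightarrow> cinner (the (T x)) y = cinner x w" by blast
  then show ?thesis
    using self_adjoint_memI[OF sa w] \<open>x \<in> dom T\<close> by simp
qed

text \<open>The graph is closed because the identity that defines the adjoint survives limits.\<close>

lemma self_adjoint_closed:
  assumes sa: "self_adjoint T" and dom: "\<And>n. X n \<in> dom T"
    and y: "X \<longlonglongrightarrow> y" and w: "(\<lambda>n. the (T (X n))) \<longlonglongrightarrow> w"
  shows "T y = Some w"
proof (rule self_adjoint_memI[OF sa])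
  fix x assume x: "x \<in> dom T"
  have "(\<lambda>n. cinner (the (T x)) (X n)) \<longlonglongrightarrow> cinner (the (T x)) y"
    by (intro tendsto_intros y)
  moreover have "cinner (the (T x)) (X n) = cinner x (the (T (X n)))" for n
    using self_adjoint_symmetric[OF sa x dom] .
  moreover have "(\<lambda>n. cinner x (the (T (X n)))) \<longlonglongrightarrow> cinner x w"
    by (intro tendsto_intros w)
  ultimately show "cinner (the (T x)) y = cinner x w"
    using LIMSEQ_unique by auto
qed

text \<open>
  Symmetry makes \<open>cinner (T y) y\<close> real, so the imaginary part of \<open>cinner ((T - z) y) y\<close> is
  \<open>- Im z * \<parallel>y\<parallel>\<^sup>2\<close>.
\<close>

lemma self_adjoint_lower_bound:
  assumes sa: "self_adjoint T" and y: "y \<in> dom T"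
  shows "\<bar>Im z\<bar> * norm y \<le> norm (the (T y) - z *\<^sub>C y)"
proof -
  let ?v = "the (T y) - z *\<^sub>C y"
  have "Im (cinner (the (T y)) y) = 0"
    using self_adjoint_symmetric[OF sa y y] cinner_commute[of "the (T y)" y]
    by (simp add: complex_eq_iff)
  then have "Im (cinner ?v y) = - Im z * (norm y)\<^sup>2"
    by (simp add: cinner_diff_left cinner_scale_left cinner_self)
  then have "\<bar>Im z\<bar> * (norm y)\<^sup>2 = \<bar>inner ?v (\<i> *\<^sub>C y)\<bar>"
    by (simp add: cinner_eq_Complex abs_mult)
  also have "\<dots> \<le> norm ?v * norm y"
    using Cauchy_Schwarz_ineq2[of ?v "\<i> *\<^sub>C y"] by simp
  finally have "(\<bar>Im z\<bar> * norm y) * norm y \<le> norm ?v * norm y"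
    by (simp add: power2_eq_square mult.assoc)
  then show ?thesis
    by (cases "norm y = 0") (simp_all add: mult_le_cancel_right)
qed

lemma linear_operator_add_scale:
  assumes lin: "linear_operator T" and "x \<in> dom T" "y \<in> dom T"
  shows "x + c *\<^sub>C y \<in> dom T"
    and "the (T (x + c *\<^sub>C y)) - z *\<^sub>C (x + c *\<^sub>C y) =
         (the (T x) - z *\<^sub>C x) + c *\<^sub>C (the (T y) - z *\<^sub>C y)"
proof -
  have sub: "ell2.subspace (dom T)" using lin by (simp add: linear_operator_def)
  have cy: "c *\<^sub>C y \<in> dom T"
    using ell2.subspace_scale[OF sub assms(3)] .
  then show "x + c *\<^sub>C y \<in> dom T"
    using ell2.subspace_add[OF sub assms(2)] by blast
  have "the (T (x + c *\<^sub>C y)) = the (T x) + c *\<^sub>C the (T y)"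
    using lin assms cy unfolding linear_operator_def by metis
  then show "the (T (x + c *\<^sub>C y)) - z *\<^sub>C (x + c *\<^sub>C y) =
         (the (T x) - z *\<^sub>C x) + c *\<^sub>C (the (T y) - z *\<^sub>C y)"
    by (auto intro!: ell2_eqI simp: algebra_simps)
qed

text \<open>
  The first variation: at a shortest vector of the line \<open>w + t v\<close> the derivative in \<open>t\<close> vanishes.
\<close>

lemma inner_eq_0_if_norm_minimal:
  fixes w v :: "'a :: real_inner"
  assumes "\<And>t :: real. norm w \<le> norm (w + t *\<^sub>R v)"
  shows "inner w v = 0"
proof (rule ccontr)
  assume ne: "inner w v \<noteq> 0"
  then have v: "inner v v > 0" by auto
  define t where "t = - inner w v / inner v v"
  have "(norm w)\<^sup>2 \<le> (norm (w + t *\<^sub>R v))\<^sup>2"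
    by (intro power_mono assms) simp
  also have "\<dots> = (norm w)\<^sup>2 + 2 * t * inner w v + t\<^sup>2 * inner v v"
    unfolding power2_norm_eq_inner
    by (simp add: inner_add_left inner_add_right inner_commute[of v w]
        power2_eq_square algebra_simps)
  also have "\<dots> = (norm w)\<^sup>2 - (inner w v)\<^sup>2 / inner v v"
    using v by (simp add: t_def power2_eq_square field_simps)
  finally show False
    using ne v by (simp add: divide_le_0_iff)
qed

text \<open>
  A best approximation to \<open>x\<close> in the range of \<open>T - z\<close> exists: a minimising sequence of images is
  Cauchy by the parallelogram law, by the lower bound so are the preimages, and \<open>T\<close> is closed. The
  remainder is orthogonal to the range, hence an eigenvector of \<open>T\<close> for \<open>cnj z\<close>, hence zero.
\<close>

lemma self_adjoint_surj:
  assumes sa: "self_adjoint T" and z: "Im z \<noteq> 0"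
  shows "\<exists>y\<in>dom T. the (T y) - z *\<^sub>C y = x"
proof -
  define R where "R y = the (T y) - z *\<^sub>C y" for y
  have lin: "linear_operator T" using sa by (simp add: self_adjoint_def)
  have sub: "ell2.subspace (dom T)" using lin by (simp add: linear_operator_def)
  have zero: "0 \<in> dom T" using ell2.subspace_0[OF sub] .
  note R_add = linear_operator_add_scale(1)[OF lin]
    linear_operator_add_scale(2)[OF lin, where z = z, folded R_def]
  define S where "S = (\<lambda>y. norm (x - R y)) ` dom T"
  define d where "d = Inf S"
  have bdd: "bdd_below S" unfolding S_def by (rule bdd_belowI2[of _ 0]) simp
  have d_le: "d \<le> norm (x - R y)" if "y \<in> dom T" for y
    unfolding d_def by (rule cInf_lower[OF _ bdd]) (use that in \<open>auto simp: S_def\<close>)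
  have d0: "0 \<le> d"
    unfolding d_def by (rule cInf_greatest) (use zero in \<open>auto simp: S_def\<close>)
  have "\<exists>y\<in>dom T. norm (x - R y) < d + 1 / real (Suc n)" for n
  proof -
    have "\<exists>s\<in>S. s < d + 1 / real (Suc n)"
      unfolding d_def by (rule cInf_lessD) (use zero in \<open>auto simp: S_def\<close>)
    then show ?thesis by (auto simp: S_def)
  qed
  then obtain Y where Y: "\<And>n. Y n \<in> dom T" "\<And>n. norm (x - R (Y n)) < d + 1 / real (Suc n)"
    by metis
  have lim: "(\<lambda>n. norm (x - R (Y n))) \<longlonglongrightarrow> d"
  proof (rule tendsto_sandwich[where f = "\<lambda>_. d" and h = "\<lambda>n. d + 1 / real (Suc n)"])
    show "(\<lambda>n. d + 1 / real (Suc n)) \<longlonglongrightarrow> d"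
      using tendsto_add[OF tendsto_const[of d] LIMSEQ_inverse_real_of_nat] by (simp add: field_simps)
    show "(\<lambda>n. d) \<longlonglongrightarrow> d" by simp
    show "\<forall>\<^sub>F n in sequentially. norm (x - R (Y n)) \<le> d + 1 / real (Suc n)"
      using Y(2) less_imp_le by (intro always_eventually) blast
  qed (use d_le Y in auto)
  have R_diff: "R (Y i) - R (Y j) = R (Y i - Y j)" "Y i - Y j \<in> dom T" for i j
    using R_add[OF Y(1) Y(1), of i "- 1" j] by simp_all
  have gap: "(norm (R (Y i) - R (Y j)))\<^sup>2
      \<le> 2 * ((norm (x - R (Y i)))\<^sup>2 - d\<^sup>2) + 2 * ((norm (x - R (Y j)))\<^sup>2 - d\<^sup>2)" for i j
  proof -
    let ?u = "x - R (Y i)" and ?v = "x - R (Y j)"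
    have half: "(1/2) *\<^sub>C Y i \<in> dom T" using ell2.subspace_scale[OF sub Y(1)] .
    have m: "(1/2) *\<^sub>C Y i + (1/2) *\<^sub>C Y j \<in> dom T"
      "R ((1/2) *\<^sub>C Y i + (1/2) *\<^sub>C Y j) = (1/2) *\<^sub>C R (Y i) + (1/2) *\<^sub>C R (Y j)"
    proof -
      show "(1/2) *\<^sub>C Y i + (1/2) *\<^sub>C Y j \<in> dom T" using R_add(1)[OF half Y(1)] .
      have "R (0 + (1/2) *\<^sub>C Y i) = R 0 + (1/2) *\<^sub>C R (Y i)"
        using R_add(2)[OF zero Y(1)] .
      moreover have "R 0 = 0"
        using R_add(2)[OF zero zero, of "-1"] by (simp add: R_def)
      ultimately show "R ((1/2) *\<^sub>C Y i + (1/2) *\<^sub>C Y j) = (1/2) *\<^sub>C R (Y i) + (1/2) *\<^sub>C R (Y j)"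
        using R_add(2)[OF half Y(1)] by simp
    qed
    \<comment> \<open>the midpoint of two images is an image, so its distance to \<open>x\<close> is at least \<open>d\<close>\<close>
    have "?u + ?v = 2 *\<^sub>R (x - R ((1/2) *\<^sub>C Y i + (1/2) *\<^sub>C Y j))"
      unfolding m by (rule ell2_eqI) (simp add: algebra_simps)
    then have "2 * d \<le> norm (?u + ?v)"
      using d_le[OF m(1)] by simp
    then have "(2 * d)\<^sup>2 \<le> (norm (?u + ?v))\<^sup>2"
      using d0 by (intro power_mono) auto
    moreover have "(norm (?u - ?v))\<^sup>2 = 2 * (norm ?u)\<^sup>2 + 2 * (norm ?v)\<^sup>2 - (norm (?u + ?v))\<^sup>2"
      by (simp add: power2_norm_eq_inner inner_add_left inner_add_right inner_diff_left
          inner_diff_right inner_commute)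
    moreover have "norm (R (Y i) - R (Y j)) = norm (?u - ?v)"
      by (simp add: norm_minus_commute)
    ultimately show ?thesis by (simp add: power_mult_distrib)
  qed
  have CauchyR: "Cauchy (\<lambda>n. R (Y n))"
  proof (rule CauchyI)
    fix e :: real assume "e > 0"
    have "(\<lambda>n. (norm (x - R (Y n)))\<^sup>2 - d\<^sup>2) \<longlonglongrightarrow> d\<^sup>2 - d\<^sup>2"
      by (intro tendsto_intros lim)
    then have "\<forall>\<^sub>F n in sequentially. (norm (x - R (Y n)))\<^sup>2 - d\<^sup>2 < e\<^sup>2 / 4"
      by (rule order_tendstoD) (use \<open>e > 0\<close> in simp)
    then obtain M where M: "\<And>n. n \<ge> M \<Longrightarrow> (norm (x - R (Y n)))\<^sup>2 - d\<^sup>2 < e\<^sup>2 / 4"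
      by (auto simp: eventually_sequentially)
    have "norm (R (Y i) - R (Y j)) < e" if "i \<ge> M" "j \<ge> M" for i j
    proof -
      have "(norm (R (Y i) - R (Y j)))\<^sup>2 < e\<^sup>2"
        using gap[of i j] M[OF that(1)] M[OF that(2)] by simp
      then show ?thesis by (rule power2_less_imp_less) (use \<open>e > 0\<close> in simp)
    qed
    then show "\<exists>M. \<forall>m\<ge>M. \<forall>n\<ge>M. norm (R (Y m) - R (Y n)) < e" by blast
  qed
  have CauchyY: "Cauchy Y"
  proof (rule CauchyI)
    fix e :: real assume "e > 0"
    then obtain M where M: "\<And>i j. i \<ge> M \<Longrightarrow> j \<ge> M \<Longrightarrow> norm (R (Y i) - R (Y j)) < \<bar>Im z\<bar> * e"
      using CauchyD[OF CauchyR, of "\<bar>Im z\<bar> * e"] z by auto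
    have "norm (Y i - Y j) < e" if "i \<ge> M" "j \<ge> M" for i j
    proof -
      have "\<bar>Im z\<bar> * norm (Y i - Y j) < \<bar>Im z\<bar> * e"
        using self_adjoint_lower_bound[OF sa R_diff(2), of z i j] M[OF that]
        by (simp add: R_diff(1) flip: R_def)
      then show ?thesis using z by simp
    qed
    then show "\<exists>M. \<forall>m\<ge>M. \<forall>n\<ge>M. norm (Y m - Y n) < e" by blast
  qed
  obtain y v where y: "Y \<longlonglongrightarrow> y" and v: "(\<lambda>n. R (Y n)) \<longlonglongrightarrow> v"
    using Cauchy_ell2_convergent[OF CauchyR] Cauchy_ell2_convergent[OF CauchyY]
    by (auto simp: convergent_def)
  have "(\<lambda>n. R (Y n) + z *\<^sub>C Y n) \<longlonglongrightarrow> v + z *\<^sub>C y"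
    by (intro tendsto_intros y v)
  then have Ty: "T y = Some (v + z *\<^sub>C y)"
    by (intro self_adjoint_closed[OF sa Y(1) y]) (simp add: R_def)
  then have ydom: "y \<in> dom T" and Ry: "R y = v" by (auto simp: R_def)
  have "(\<lambda>n. norm (x - R (Y n))) \<longlonglongrightarrow> norm (x - v)"
    by (intro tendsto_intros v)
  then have dv: "norm (x - v) = d"
    using lim LIMSEQ_unique by blast
  define w where "w = x - v"
  have orth: "inner w (c *\<^sub>C R u) = 0" if u: "u \<in> dom T" for u c
  proof (rule inner_eq_0_if_norm_minimal)
    fix t :: real
    have eq: "w + t *\<^sub>R (c *\<^sub>C R u) = x - R (y + (- of_real t * c) *\<^sub>C u)"
      unfolding R_add(2)[OF ydom u] Ry w_def
      by (rule ell2_eqI) (simp add: algebra_simps)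
    show "norm w \<le> norm (w + t *\<^sub>R (c *\<^sub>C R u))"
      unfolding eq using d_le[OF R_add(1)[OF ydom u, of "- of_real t * c"]] dv by (simp add: w_def)
  qed
  have "cinner (R u) w = 0" if "u \<in> dom T" for u
    using orth[OF that, of 1] orth[OF that, of \<i>] cinner_commute[of w "R u"]
    by (simp add: cinner_eq_Complex[of w] complex_eq_iff)
  then have "T w = Some (cnj z *\<^sub>C w)"
    by (intro self_adjoint_memI[OF sa])
      (simp add: R_def cinner_diff_left cinner_scale_left cinner_scale_right)
  then have "\<bar>Im (cnj z)\<bar> * norm w \<le> 0"
    using self_adjoint_lower_bound[OF sa, of w "cnj z"] by (simp add: domI)
  then have "w = 0" using z by (simp add: mult_le_0_iff)
  then show ?thesis using ydom Ry by (auto simp: w_def R_def)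
qed

lemma resolvent_solves:
  assumes sa: "self_adjoint T" and z: "Im z \<noteq> 0"
  shows "resolvent z T x \<in> dom T" "the (T (resolvent z T x)) - z *\<^sub>C resolvent z T x = x"
proof -
  have "x \<in> (\<lambda>y. the (T y) - z *\<^sub>C y) ` dom T"
    using self_adjoint_surj[OF sa z, of x] by auto
  then show "resolvent z T x \<in> dom T" "the (T (resolvent z T x)) - z *\<^sub>C resolvent z T x = x"
    unfolding resolvent_def by (rule inv_into_into, rule f_inv_into_f)
qed

text \<open>
  \<open>T - z\<close> maps the error of \<open>y\<close> to the residual of \<open>y\<close>.
\<close>

lemma resolvent_error_le:
  assumes sa: "self_adjoint T" and z: "Im z \<noteq> 0" and y: "y \<in> dom T"
  shows "norm (y - resolvent z T x) \<le> norm (the (T y) - z *\<^sub>C y - x) / \<bar>Im z\<bar>"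
proof -
  let ?r = "resolvent z T x"
  have lin: "linear_operator T" using sa by (simp add: self_adjoint_def)
  note d = linear_operator_add_scale[OF lin y resolvent_solves(1)[OF sa z], of "-1" x]
  have "y - ?r \<in> dom T" "the (T (y - ?r)) - z *\<^sub>C (y - ?r) = the (T y) - z *\<^sub>C y - x"
    using d(1) d(2)[of z] resolvent_solves(2)[OF sa z, of x] by simp_all
  then have "\<bar>Im z\<bar> * norm (y - ?r) \<le> norm (the (T y) - z *\<^sub>C y - x)"
    using self_adjoint_lower_bound[OF sa, of "y - ?r" z] by simp
  then show ?thesis using z by (simp add: field_simps)
qed

text \<open>This is where the core is used: \<open>(T - z)\<close> maps even the finitely supported vectors onto a
  dense set.\<close>

lemma core_dense_range:
  assumes sa: "self_adjoint T" and core: "is_core D T" and z: "Im z \<noteq> 0" and e: "e > 0"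
  shows "\<exists>y\<in>D. norm (the (T y) - z *\<^sub>C y - x) < e"
proof -
  let ?r = "resolvent z T x"
  note r = resolvent_solves[OF sa z, of x]
  have "(?r, the (T ?r)) \<in> Map.graph T"
    using r(1) by (auto simp: graph_def)
  then have "(?r, the (T ?r)) \<in> closure (Map.graph (T |` D))"
    using core by (simp add: is_core_def)
  moreover define \<delta> where "\<delta> = e / (2 + cmod z)"
  moreover have "\<delta> > 0"
    using e by (simp add: \<delta>_def add_pos_nonneg)
  ultimately obtain p where "\<delta> > 0" and p: "p \<in> Map.graph (T |` D)" "dist p (?r, the (T ?r)) < \<delta>"
    unfolding closure_approachable by blast
  obtain y where y: "y \<in> D" "p = (y, the (T y))"
    using p(1) by (auto simp: graph_def restrict_map_def split: if_splits)
  have "norm (y - ?r) < \<delta>" "norm (the (T y) - the (T ?r)) < \<delta>"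
    using p(2) dist_fst_le[of p "(?r, the (T ?r))"] dist_snd_le[of p "(?r, the (T ?r))"]
    by (auto simp: y dist_norm)
  then have "norm (the (T y) - the (T ?r)) + cmod z * norm (y - ?r) < \<delta> + cmod z * \<delta>"
    by (intro add_less_le_mono mult_left_mono) auto
  also have "\<delta> + cmod z * \<delta> \<le> e"
  proof -
    have "2 + cmod z > 0" using norm_ge_zero[of z] by linarith
    then have "\<delta> * (2 + cmod z) = e" by (simp add: \<delta>_def)
    then show ?thesis using \<open>\<delta> > 0\<close> by (simp add: algebra_simps)
  qed
  finally have bound: "norm (the (T y) - the (T ?r)) + cmod z * norm (y - ?r) < e" .
  have eq: "the (T y) - z *\<^sub>C y - x = (the (T y) - the (T ?r)) - z *\<^sub>C (y - ?r)"
    using r(2) by (simp add: scale_diff algebra_simps)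
  have "norm (the (T y) - z *\<^sub>C y - x) < e"
    unfolding eq using norm_triangle_ineq4[of "the (T y) - the (T ?r)" "z *\<^sub>C (y - ?r)"] bound by simp
  then show ?thesis using y(1) by blast
qed


section \<open>Runs of a machine and general algorithms\<close>

lemma bss_run_Suc: "bss_run P orc n (Suc t) = bss_step P orc (bss_run P orc n t)"
  by (simp add: bss_run_def)

lemma bss_run_halted:
  assumes "label (bss_run P orc n t) \<ge> length P" and "t \<le> u"
  shows "bss_run P orc n u = bss_run P orc n t"
  using assms(2)
proof (induction u rule: dec_induct)
  case (step u)
  then show ?case using assms(1) by (simp add: bss_run_Suc bss_step_def)
qed simp

lemma bss_computes_unique:
  assumes "bss_computes P orc n out" "bss_computes P orc n out'"
  shows "out = out'"
proof -
  obtain t t' where t: "label (bss_run P orc n t) \<ge> length P" "bss_output (bss_run P orc n t) = out"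
    and t': "label (bss_run P orc n t') \<ge> length P" "bss_output (bss_run P orc n t') = out'"
    using assms by (auto simp: bss_computes_def)
  have "bss_run P orc n t = bss_run P orc n t'"
    using bss_run_halted[OF t(1), of t'] bss_run_halted[OF t'(1), of t] by (cases "t \<le> t'") auto
  then show ?thesis using t(2) t'(2) by simp
qed

text \<open>
  After halting a run no longer meets a query node.
\<close>

lemma finite_bss_queries:
  assumes halt: "label (bss_run P orc n t) \<ge> length P"
  shows "finite (bss_queries P orc n)"
proof -
  have "bss_queries P orc n \<subseteq>
    (\<Union>u<t. case P ! label (bss_run P orc n u) of
       Query q k l \<Rightarrow> {(q, addr1 (bss_run P orc n u), addr2 (bss_run P orc n u))} | _ \<Rightarrow> {})"
  proof
    fix p assume "p \<in> bss_queries P orc n"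
    then obtain q k l u where p: "p = (q, addr1 (bss_run P orc n u), addr2 (bss_run P orc n u))"
      and u: "label (bss_run P orc n u) < length P" "P ! label (bss_run P orc n u) = Query q k l"
      by (auto simp: bss_queries_def)
    have "u < t"
      using bss_run_halted[OF halt, of u] halt u(1) by (cases "t \<le> u") auto
    then show "p \<in> (\<Union>u<t. case P ! label (bss_run P orc n u) of
       Query q k l \<Rightarrow> {(q, addr1 (bss_run P orc n u), addr2 (bss_run P orc n u))} | _ \<Rightarrow> {})"
      using p u(2) by force
  qed
  moreover have "finite (\<Union>u<t. case P ! label (bss_run P orc n u) of
       Query q k l \<Rightarrow> {(q, addr1 (bss_run P orc n u), addr2 (bss_run P orc n u))} | _ \<Rightarrow> {})"
    by (auto split: bss_node.split)
  ultimately show ?thesis by (rule finite_subset)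
qed

text \<open>A run sees the oracle only through its queries.\<close>

lemma bss_run_cong:
  assumes "\<And>q i j. (q, i, j) \<in> bss_queries P orc n \<Longrightarrow> orc' q i j = orc q i j"
  shows "bss_run P orc' n t = bss_run P orc n t"
proof (induction t)
  case 0
  show ?case by (simp add: bss_run_def)
next
  case (Suc t)
  let ?s = "bss_run P orc n t"
  have "bss_step P orc' ?s = bss_step P orc ?s"
  proof (cases "label ?s < length P")
    case True
    show ?thesis
    proof (cases "P ! label ?s")
      case (Query q k l)
      then have "(q, addr1 ?s, addr2 ?s) \<in> bss_queries P orc n"
        using True by (auto simp: bss_queries_def)
      then show ?thesis using True Query assms by (simp add: bss_step_def)
    qed (use True in \<open>simp_all add: bss_step_def\<close>)
  qed (simp add: bss_step_def)
  then show ?case using Suc by (simp add: bss_run_Suc)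
qed

text \<open>
  The set of evaluations that a halting run asks for serves as \<open>\<Lambda>\<Gamma>\<close>: it is finite, and an input that
  agrees on it produces the same run, hence the same output and the same set. Letting the first node
  be a query makes it nonempty.
\<close>

lemma arithmetic_algorithmsI:
  fixes \<Gamma> :: "nat \<Rightarrow> 'a \<Rightarrow> 'm :: metric_space"
  assumes query: "P = Query q k l # P'"
    and computes: "\<And>n A. n \<ge> 1 \<Longrightarrow> A \<in> \<Omega> \<Longrightarrow>
      \<exists>out. bss_computes P (\<lambda>q i j. ev q i j A) n out \<and> \<Gamma> n A = dec out"
  shows "arithmetic_algorithms \<Omega> ev dec \<Gamma>"
proof -
  define orc where "orc A = (\<lambda>q i j. ev q i j A)" for A
  define \<Lambda>\<Gamma> where "\<Lambda>\<Gamma> n A = {ev q i j |q i j. (q, i, j) \<in> bss_queries P (orc A) n}" for n A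
  note computes' = computes[folded orc_def]
  have "general_algorithm \<Omega> {ev q i j |q i j. True} (\<Gamma> n) (\<Lambda>\<Gamma> n)" if n: "n \<ge> 1" for n
    unfolding general_algorithm_def
  proof (intro ballI conjI impI)
    fix A assume A: "A \<in> \<Omega>"
    then obtain out where out: "bss_computes P (orc A) n out" "\<Gamma> n A = dec out"
      using computes'[OF n] by blast
    then obtain t where "label (bss_run P (orc A) n t) \<ge> length P"
      by (auto simp: bss_computes_def)
    then have "finite (bss_queries P (orc A) n)"
      by (rule finite_bss_queries)
    moreover have "\<Lambda>\<Gamma> n A = (\<lambda>(q, i, j). ev q i j) ` bss_queries P (orc A) n"
      by (force simp: \<Lambda>\<Gamma>_def)
    ultimately show "finite (\<Lambda>\<Gamma> n A)" by simp
    have "(q, 0, 0) \<in> bss_queries P (orc A) n"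
      unfolding bss_queries_def
      by (rule CollectI, rule exI[of _ q], rule exI[of _ k], rule exI[of _ l], rule exI[of _ 0])
        (simp add: bss_run_def bss_init_def query)
    then show "\<Lambda>\<Gamma> n A \<noteq> {}" by (auto simp: \<Lambda>\<Gamma>_def)
    show "\<Lambda>\<Gamma> n A \<subseteq> {ev q i j |q i j. True}" by (auto simp: \<Lambda>\<Gamma>_def)
    fix B assume B: "B \<in> \<Omega>" and eq: "\<forall>g\<in>\<Lambda>\<Gamma> n A. g B = g A"
    have run: "bss_run P (orc B) n t = bss_run P (orc A) n t" for t
      by (rule bss_run_cong) (use eq in \<open>auto simp: \<Lambda>\<Gamma>_def orc_def\<close>)
    then have "bss_computes P (orc B) n out"
      using out(1) by (simp add: bss_computes_def)
    then show "\<Gamma> n B = \<Gamma> n A"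
      using computes'[OF n B] bss_computes_unique out(2) by metis
    show "\<Lambda>\<Gamma> n B = \<Lambda>\<Gamma> n A"
      using run by (simp add: \<Lambda>\<Gamma>_def bss_queries_def)
  qed
  then show ?thesis
    unfolding arithmetic_algorithms_def
    by (intro exI[of _ \<Lambda>\<Gamma>] exI[of _ P] allI impI conjI ballI)
      (use computes in \<open>auto simp: \<Lambda>\<Gamma>_def orc_def\<close>)
qed


section \<open>A structured language for the machine\<close>

text \<open>
  Programs act on the memory alone: an address is a value in memory, and the address registers are
  loaded from it by a counting loop. That loop works in cell 1 and ends with 0 there; as cell 1 is
  required to hold 0 beforehand, it leaves no trace. The test of \<open>Cond\<close> and of \<open>Until\<close> succeeds on
  nonnegative values, like that of \<open>Branch\<close>, and \<open>Until\<close> tests before every round.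
\<close>

datatype 'q prog =
    Assign nat rational_function
  | Load nat rational_function
  | Store rational_function nat
  | Ask 'q rational_function rational_function nat nat
  | Seq "'q prog" "'q prog" (infixr ";;" 60)
  | Cond rational_function "'q prog" "'q prog"
  | Until rational_function "'q prog"

inductive exec :: "'q oracle_function \<Rightarrow> 'q prog \<Rightarrow> (nat \<Rightarrow> real) \<Rightarrow> (nat \<Rightarrow> real) \<Rightarrow> bool"
  for orc where
  Assign: "exec orc (Assign k h) m (m(k := rf_value h m))"
| Load: "m 1 = 0 \<Longrightarrow> rf_value h m = real a \<Longrightarrow> exec orc (Load k h) m (m(k := m a))"
| Store: "m 1 = 0 \<Longrightarrow> rf_value h m = real a \<Longrightarrow> exec orc (Store h k) m (m(a := m k))"
| Ask: "m 1 = 0 \<Longrightarrow> rf_value g m = real i \<Longrightarrow> rf_value h m = real j \<Longrightarrow>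
    exec orc (Ask q g h k l) m (m(k := Re (orc q i j), l := Im (orc q i j)))"
| Seq: "exec orc c m m' \<Longrightarrow> exec orc d m' m'' \<Longrightarrow> exec orc (c ;; d) m m''"
| Cond_nonneg: "rf_value h m \<ge> 0 \<Longrightarrow> exec orc c m m' \<Longrightarrow> exec orc (Cond h c d) m m'"
| Cond_neg: "rf_value h m < 0 \<Longrightarrow> exec orc d m m' \<Longrightarrow> exec orc (Cond h c d) m m'"
| Until_exit: "rf_value h m \<ge> 0 \<Longrightarrow> exec orc (Until h c) m m"
| Until_loop: "rf_value h m < 0 \<Longrightarrow> exec orc c m m' \<Longrightarrow> exec orc (Until h c) m' m'' \<Longrightarrow>
    exec orc (Until h c) m m''"

text \<open>The first argument of the code generators is the label of the first node.\<close>

definition count_addr1 :: "nat \<Rightarrow> rational_function \<Rightarrow> 'q bss_node list" where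
  "count_addr1 p h = [Reset1, Compute 1 h, Branch (Minus (Const 0) (Cell 1)) (p + 6), Incr1,
     Compute 1 (Minus (Cell 1) (Const 1)), Branch (Const 0) (p + 2)]"

definition count_addr2 :: "nat \<Rightarrow> rational_function \<Rightarrow> 'q bss_node list" where
  "count_addr2 p h = [Reset2, Compute 1 h, Branch (Minus (Const 0) (Cell 1)) (p + 6), Incr2,
     Compute 1 (Minus (Cell 1) (Const 1)), Branch (Const 0) (p + 2)]"

definition count_addrs :: "nat \<Rightarrow> rational_function \<Rightarrow> rational_function \<Rightarrow> 'q bss_node list" where
  "count_addrs p g h = count_addr1 p g @ count_addr2 (p + 6) h"

primrec compile :: "nat \<Rightarrow> 'q prog \<Rightarrow> 'q bss_node list" where
  "compile p (Assign k h) = [Compute k h]"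
| "compile p (Load k h) = count_addrs p h (Const (of_nat k)) @ [Copy]"
| "compile p (Store h k) = count_addrs p (Const (of_nat k)) h @ [Copy]"
| "compile p (Ask q g h k l) = count_addrs p g h @ [Query q k l]"
| "compile p (c ;; d) = (let C = compile p c in C @ compile (p + length C) d)"
| "compile p (Cond h c d) =
     (let D = compile (p + 1) d; C = compile (p + length D + 2) c
      in Branch h (p + length D + 2) # D @ Branch (Const 0) (p + length D + 2 + length C) # C)"
| "compile p (Until h c) =
     (let C = compile (p + 1) c
      in Branch h (p + length C + 2) # C @ [Branch (Const 0) p])"

definition reaches :: "'q bss_node list \<Rightarrow> 'q oracle_function \<Rightarrow> bss_state \<Rightarrow> bss_state \<Rightarrow> bool" where
  "reaches P orc s s' \<longleftrightarrow> (\<exists>t. (bss_step P orc ^^ t) s = s')"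

lemma reaches_refl: "reaches P orc s s"
  unfolding reaches_def by (rule exI[of _ 0]) simp

lemma reaches_trans [trans]:
  "reaches P orc s s' \<Longrightarrow> reaches P orc s' s'' \<Longrightarrow> reaches P orc s s''"
  unfolding reaches_def by (metis funpow_add o_apply)

lemma reaches_1: "bss_step P orc s = s' \<Longrightarrow> reaches P orc s s'"
  unfolding reaches_def by (rule exI[of _ 1]) simp

abbreviation State :: "nat \<Rightarrow> nat \<Rightarrow> nat \<Rightarrow> (nat \<Rightarrow> real) \<Rightarrow> bss_state" where
  "State p a b m \<equiv> \<lparr>label = p, addr1 = a, addr2 = b, mem = m\<rparr>"

definition code_at :: "'q bss_node list \<Rightarrow> nat \<Rightarrow> 'q bss_node list \<Rightarrow> bool" where
  "code_at P p C \<longleftrightarrow> (\<exists>pre post. P = pre @ C @ post \<and> length pre = p)"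

lemma code_at_append:
  "code_at P p (C @ D) \<longleftrightarrow> code_at P p C \<and> code_at P (p + length C) D"
proof (intro iffI conjI)
  assume "code_at P p (C @ D)"
  then obtain pre post where P: "P = pre @ (C @ D) @ post" "length pre = p"
    by (auto simp: code_at_def)
  show "code_at P p C"
    unfolding code_at_def by (rule exI[of _ pre], rule exI[of _ "D @ post"]) (use P in simp)
  show "code_at P (p + length C) D"
    unfolding code_at_def by (rule exI[of _ "pre @ C"], rule exI[of _ post]) (use P in simp)
next
  assume "code_at P p C \<and> code_at P (p + length C) D"
  then obtain pre post pre' post' where P: "P = pre @ C @ post" "length pre = p"
    and P': "P = pre' @ D @ post'" "length pre' = p + length C"
    unfolding code_at_def by blast
  have "post = drop (length pre') P" using P P'(2) by simp
  also have "\<dots> = D @ post'" using P'(1) by simp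
  finally have "post = D @ post'" .
  then show "code_at P p (C @ D)"
    unfolding code_at_def by (intro exI[of _ pre] exI[of _ post']) (use P in simp)
qed

lemma code_at_nth:
  "code_at P p C \<Longrightarrow> i < length C \<Longrightarrow> p + i < length P \<and> P ! (p + i) = C ! i"
  by (auto simp: code_at_def nth_append)

lemma reaches_count_addr1:
  assumes code: "code_at P p (count_addr1 p h)" and h: "rf_value h m = real a" and m: "m 1 = 0"
  shows "reaches P orc (State p a0 b m) (State (p + 6) a b m)"
proof -
  have nodes: "p < length P" "P ! p = Reset1"
    "p + 1 < length P" "P ! (p + 1) = Compute 1 h"
    "p + 2 < length P" "P ! (p + 2) = Branch (Minus (Const 0) (Cell 1)) (p + 6)"
    "p + 3 < length P" "P ! (p + 3) = Incr1"
    "p + 4 < length P" "P ! (p + 4) = Compute 1 (Minus (Cell 1) (Const 1))"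
    "p + 5 < length P" "P ! (p + 5) = Branch (Const 0) (p + 2)"
    using code_at_nth[OF code, of 0] code_at_nth[OF code, of 1] code_at_nth[OF code, of 2]
      code_at_nth[OF code, of 3] code_at_nth[OF code, of 4] code_at_nth[OF code, of 5]
    by (simp_all add: count_addr1_def)
  have loop: "reaches P orc (State (p + 2) c b (m(1 := real d))) (State (p + 6) (c + d) b m)" for c d
  proof (induction d arbitrary: c)
    case 0
    have "m(1 := 0) = m" using m by auto
    then show ?case
      by (intro reaches_1) (use nodes m in \<open>simp add: bss_step_def\<close>)
  next
    case (Suc d)
    have "reaches P orc (State (p + 2) c b (m(1 := real (Suc d))))
        (State (p + 3) c b (m(1 := real (Suc d))))"
      by (rule reaches_1) (use nodes in \<open>simp add: bss_step_def\<close>)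
    also have "reaches P orc \<dots> (State (p + 4) (c + 1) b (m(1 := real (Suc d))))"
      by (rule reaches_1) (use nodes in \<open>simp add: bss_step_def\<close>)
    also have "reaches P orc \<dots> (State (p + 5) (c + 1) b (m(1 := real d)))"
      by (rule reaches_1) (use nodes in \<open>simp add: bss_step_def\<close>)
    also have "reaches P orc \<dots> (State (p + 2) (c + 1) b (m(1 := real d)))"
      by (rule reaches_1) (use nodes in \<open>simp add: bss_step_def\<close>)
    also have "reaches P orc \<dots> (State (p + 6) (c + Suc d) b m)"
      using Suc[of "c + 1"] by (simp del: fun_upd_apply)
    finally show ?case .
  qed
  have "reaches P orc (State p a0 b m) (State (p + 1) 0 b m)"
    by (rule reaches_1) (use nodes in \<open>simp add: bss_step_def\<close>)
  also have "reaches P orc \<dots> (State (p + 2) 0 b (m(1 := real a)))"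
    by (rule reaches_1) (use nodes h in \<open>simp add: bss_step_def\<close>)
  also have "reaches P orc \<dots> (State (p + 6) a b m)"
    using loop[of 0 a] by simp
  finally show ?thesis .
qed

lemma reaches_count_addr2:
  assumes code: "code_at P p (count_addr2 p h)" and h: "rf_value h m = real b" and m: "m 1 = 0"
  shows "reaches P orc (State p a b0 m) (State (p + 6) a b m)"
proof -
  have nodes: "p < length P" "P ! p = Reset2"
    "p + 1 < length P" "P ! (p + 1) = Compute 1 h"
    "p + 2 < length P" "P ! (p + 2) = Branch (Minus (Const 0) (Cell 1)) (p + 6)"
    "p + 3 < length P" "P ! (p + 3) = Incr2"
    "p + 4 < length P" "P ! (p + 4) = Compute 1 (Minus (Cell 1) (Const 1))"
    "p + 5 < length P" "P ! (p + 5) = Branch (Const 0) (p + 2)"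
    using code_at_nth[OF code, of 0] code_at_nth[OF code, of 1] code_at_nth[OF code, of 2]
      code_at_nth[OF code, of 3] code_at_nth[OF code, of 4] code_at_nth[OF code, of 5]
    by (simp_all add: count_addr2_def)
  have loop: "reaches P orc (State (p + 2) a c (m(1 := real d))) (State (p + 6) a (c + d) m)" for c d
  proof (induction d arbitrary: c)
    case 0
    have "m(1 := 0) = m" using m by auto
    then show ?case
      by (intro reaches_1) (use nodes m in \<open>simp add: bss_step_def\<close>)
  next
    case (Suc d)
    have "reaches P orc (State (p + 2) a c (m(1 := real (Suc d))))
        (State (p + 3) a c (m(1 := real (Suc d))))"
      by (rule reaches_1) (use nodes in \<open>simp add: bss_step_def\<close>)
    also have "reaches P orc \<dots> (State (p + 4) a (c + 1) (m(1 := real (Suc d))))"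
      by (rule reaches_1) (use nodes in \<open>simp add: bss_step_def\<close>)
    also have "reaches P orc \<dots> (State (p + 5) a (c + 1) (m(1 := real d)))"
      by (rule reaches_1) (use nodes in \<open>simp add: bss_step_def\<close>)
    also have "reaches P orc \<dots> (State (p + 2) a (c + 1) (m(1 := real d)))"
      by (rule reaches_1) (use nodes in \<open>simp add: bss_step_def\<close>)
    also have "reaches P orc \<dots> (State (p + 6) a (c + Suc d) m)"
      using Suc[of "c + 1"] by (simp del: fun_upd_apply)
    finally show ?case .
  qed
  have "reaches P orc (State p a b0 m) (State (p + 1) a 0 m)"
    by (rule reaches_1) (use nodes in \<open>simp add: bss_step_def\<close>)
  also have "reaches P orc \<dots> (State (p + 2) a 0 (m(1 := real b)))"
    by (rule reaches_1) (use nodes h in \<open>simp add: bss_step_def\<close>)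
  also have "reaches P orc \<dots> (State (p + 6) a b m)"
    using loop[of 0 b] by simp
  finally show ?thesis .
qed


lemma length_count_addrs [simp]: "length (count_addrs p g h) = 12"
  by (simp add: count_addrs_def count_addr1_def count_addr2_def)

lemma reaches_count_addrs:
  assumes "code_at P p (count_addrs p g h)" "rf_value g m = real a" "rf_value h m = real b" "m 1 = 0"
  shows "reaches P orc (State p a0 b0 m) (State (p + 12) a b m)"
proof -
  have l: "length (count_addr1 p g) = 6" by (simp add: count_addr1_def)
  have "code_at P p (count_addr1 p g)" "code_at P (p + 6) (count_addr2 (p + 6) h)"
    using assms(1) by (simp_all add: count_addrs_def code_at_append l)
  from reaches_trans[OF reaches_count_addr1[OF this(1) assms(2,4)]
      reaches_count_addr2[OF this(2) assms(3,4)]]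
  have "reaches P orc (State p a0 b0 m) (State (p + 6 + 6) a b m)" .
  then show ?thesis by (simp add: add.commute)
qed

lemma reaches_snoc:
  assumes "code_at P p (C @ [N])" and "reaches P orc (State p a0 b0 m) (State (p + length C) a b m)"
    and "bss_exec orc N (State (p + length C) a b m) = s"
  shows "reaches P orc (State p a0 b0 m) s"
proof -
  have "p + length C < length P" "P ! (p + length C) = N"
    using code_at_nth[OF assms(1), of "length C"] by simp_all
  then show ?thesis
    using assms(3) by (intro reaches_trans[OF assms(2)] reaches_1) (simp add: bss_step_def)
qed

text \<open>
  The address registers carry nothing from one command to the next, so they are arbitrary before
  and after.
\<close>

theorem compile_correct:
  assumes "exec orc c m m'" and "code_at P p (compile p c)"
  shows "\<exists>a' b'. reaches P orc (State p a b m) (State (p + length (compile p c)) a' b' m')"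
  using assms
proof (induction arbitrary: p a b rule: exec.induct)
  case (Assign k h m)
  then have "p < length P" "P ! p = Compute k h"
    using code_at_nth[of P p _ 0] by force+
  then have "reaches P orc (State p a b m) (State (p + 1) a b (m(k := rf_value h m)))"
    by (intro reaches_1) (simp add: bss_step_def)
  then show ?case 
    by (intro exI) (simp del: fun_upd_apply)
next
  case (Load m h i k)
  let ?C = "count_addrs p h (Const (of_nat k))"
  have "reaches P orc (State p a b m) (State (p + 13) i k (m(k := m i)))"
  proof (rule reaches_snoc)
    show code: "code_at P p (?C @ [Copy])"
      using Load.prems by simp
    show "reaches P orc (State p a b m) (State (p + length ?C) i k m)"
      unfolding length_count_addrs
      by (rule reaches_count_addrs[where g = h and h = "Const (of_nat k)"])
        (use code Load.hyps in \<open>simp_all add: code_at_append\<close>)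
  qed simp
  then show ?case
    by (intro exI) (simp del: fun_upd_apply)
next
  case (Store m h i k)
  let ?C = "count_addrs p (Const (of_nat k)) h"
  have "reaches P orc (State p a b m) (State (p + 13) k i (m(i := m k)))"
  proof (rule reaches_snoc)
    show code: "code_at P p (?C @ [Copy])"
      using Store.prems by simp
    show "reaches P orc (State p a b m) (State (p + length ?C) k i m)"
      unfolding length_count_addrs
      by (rule reaches_count_addrs[where g = "Const (of_nat k)" and h = h])
        (use code Store.hyps in \<open>simp_all add: code_at_append\<close>)
  qed simp
  then show ?case
    by (intro exI) (simp del: fun_upd_apply)
next
  case (Ask m g i h j q k l)
  let ?C = "count_addrs p g h"
  have "reaches P orc (State p a b m) (State (p + 13) i j (m(k := Re (orc q i j), l := Im (orc q i j))))"
  proof (rule reaches_snoc)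
    show code: "code_at P p (?C @ [Query q k l])"
      using Ask.prems by simp
    show "reaches P orc (State p a b m) (State (p + length ?C) i j m)"
      unfolding length_count_addrs
      by (rule reaches_count_addrs[where g = g and h = h])
        (use code Ask.hyps in \<open>simp_all add: code_at_append\<close>)
  qed simp
  then show ?case
    by (intro exI) (simp del: fun_upd_apply)
next
  case (Seq c m m' d m'')
  let ?C = "compile p c"
  have "code_at P p ?C" "code_at P (p + length ?C) (compile (p + length ?C) d)"
    using Seq.prems by (simp_all add: Let_def code_at_append)
  then show ?case
    using Seq.IH(1)[of p a b] Seq.IH(2) reaches_trans by (fastforce simp: Let_def add.assoc)
next
  case (Cond_nonneg h m c m' d)
  let ?D = "compile (p + 1) d"
  let ?q = "p + length ?D + 2"
  let ?C = "compile ?q c"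
  have code: "code_at P p (Branch h ?q # ?D @ Branch (Const 0) (?q + length ?C) # ?C)"
    using Cond_nonneg.prems by (simp add: Let_def)
  have C: "code_at P ?q ?C"
    using code code_at_append[of P p "Branch h ?q # ?D @ [Branch (Const 0) (?q + length ?C)]" ?C]
    by simp
  have "reaches P orc (State p a b m) (State ?q a b m)"
    using code_at_nth[OF code, of 0] Cond_nonneg.hyps by (intro reaches_1) (simp add: bss_step_def)
  with Cond_nonneg.IH[OF C] reaches_trans show ?case
    by (fastforce simp: Let_def add.assoc)
next
  case (Cond_neg h m d m' c)
  let ?D = "compile (p + 1) d"
  let ?q = "p + length ?D + 2"
  let ?C = "compile ?q c"
  have code: "code_at P p ([Branch h ?q] @ ?D @ [Branch (Const 0) (?q + length ?C)] @ ?C)"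
    using Cond_neg.prems by (simp add: Let_def)
  have D: "code_at P (p + 1) ?D"
    using code unfolding code_at_append by simp
  obtain a' b' where r: "reaches P orc (State (p + 1) a b m) (State (p + 1 + length ?D) a' b' m')"
    using Cond_neg.IH[OF D] by blast
  have "reaches P orc (State p a b m) (State (p + 1) a b m)"
    using code_at_nth[OF code, of 0] Cond_neg.hyps by (intro reaches_1) (simp add: bss_step_def)
  also note r
  also have "reaches P orc (State (p + 1 + length ?D) a' b' m') (State (?q + length ?C) a' b' m')"
    using code_at_nth[OF code, of "Suc (length ?D)"]
    by (intro reaches_1) (simp add: bss_step_def nth_append)
  finally show ?case by (auto simp: Let_def add.assoc)
next
  case (Until_exit h m c)
  have "reaches P orc (State p a b m) (State (p + length (compile (p + 1) c) + 2) a b m)"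
    using code_at_nth[OF Until_exit.prems, of 0] Until_exit.hyps
    by (intro reaches_1) (simp add: bss_step_def Let_def)
  then show ?case by (auto simp: Let_def)
next
  case (Until_loop h m c m' m'')
  let ?C = "compile (p + 1) c"
  have code: "code_at P p ([Branch h (p + length ?C + 2)] @ ?C @ [Branch (Const 0) p])"
    using Until_loop.prems by (simp add: Let_def)
  have C: "code_at P (p + 1) ?C"
    using code unfolding code_at_append by simp
  obtain a' b' where r: "reaches P orc (State (p + 1) a b m) (State (p + 1 + length ?C) a' b' m')"
    using Until_loop.IH(1)[OF C] by blast
  have "reaches P orc (State p a b m) (State (p + 1) a b m)"
    using code_at_nth[OF code, of 0] Until_loop.hyps by (intro reaches_1) (simp add: bss_step_def)
  also note r
  also have "reaches P orc (State (p + 1 + length ?C) a' b' m') (State p a' b' m')"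
    using code_at_nth[OF code, of "Suc (length ?C)"]
    by (intro reaches_1) (simp add: bss_step_def nth_append)
  finally show ?case
    using Until_loop.IH(2)[OF Until_loop.prems, of a' b'] reaches_trans by blast
qed


section \<open>Total correctness of programs\<close>

text \<open>
  Execution is deterministic, so this is total correctness: the program halts in a memory
  satisfying \<open>Q\<close>.
\<close>

definition wp :: "'q oracle_function \<Rightarrow> 'q prog \<Rightarrow> ((nat \<Rightarrow> real) \<Rightarrow> bool) \<Rightarrow> (nat \<Rightarrow> real) \<Rightarrow> bool" where
  "wp orc c Q m \<longleftrightarrow> (\<exists>m'. exec orc c m m' \<and> Q m')"

lemma wp_Assign: "Q (m(k := rf_value h m)) \<Longrightarrow> wp orc (Assign k h) Q m"
  unfolding wp_def by (blast intro: exec.intros)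

lemma wp_Load: "m 1 = 0 \<Longrightarrow> rf_value h m = real a \<Longrightarrow> Q (m(k := m a)) \<Longrightarrow> wp orc (Load k h) Q m"
  unfolding wp_def by (blast intro: exec.intros)

lemma wp_Store: "m 1 = 0 \<Longrightarrow> rf_value h m = real a \<Longrightarrow> Q (m(a := m k)) \<Longrightarrow> wp orc (Store h k) Q m"
  unfolding wp_def by (blast intro: exec.intros)

lemma wp_Ask:
  "m 1 = 0 \<Longrightarrow> rf_value g m = real i \<Longrightarrow> rf_value h m = real j \<Longrightarrow>
   Q (m(k := Re (orc q i j), l := Im (orc q i j))) \<Longrightarrow> wp orc (Ask q g h k l) Q m"
  unfolding wp_def by (blast intro: exec.intros)

lemma wp_Seq: "wp orc c (wp orc d Q) m \<Longrightarrow> wp orc (c ;; d) Q m"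
  unfolding wp_def by (blast intro: exec.intros)

lemma wp_Cond:
  "(rf_value h m \<ge> 0 \<Longrightarrow> wp orc c Q m) \<Longrightarrow> (rf_value h m < 0 \<Longrightarrow> wp orc d Q m) \<Longrightarrow>
   wp orc (Cond h c d) Q m"
  unfolding wp_def by (cases "rf_value h m \<ge> 0") (auto intro: exec.intros simp: not_le)

lemma wp_mono: "wp orc c Q m \<Longrightarrow> (\<And>m'. Q m' \<Longrightarrow> R m') \<Longrightarrow> wp orc c R m"
  unfolding wp_def by blast

text \<open>
  The index of the invariant decreases in every round and thus bounds the number of rounds.
\<close>

lemma wp_Until:
  fixes I :: "nat \<Rightarrow> (nat \<Rightarrow> real) \<Rightarrow> bool"
  assumes "I t m"
    and body: "\<And>t m. I t m \<Longrightarrow> rf_value h m < 0 \<Longrightarrow> wp orc c (\<lambda>m'. \<exists>t'<t. I t' m') m"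
    and exit: "\<And>t m. I t m \<Longrightarrow> rf_value h m \<ge> 0 \<Longrightarrow> Q m"
  shows "wp orc (Until h c) Q m"
  using assms(1)
proof (induction t arbitrary: m rule: less_induct)
  case (less t)
  show ?case
  proof (cases "rf_value h m \<ge> 0")
    case True
    then show ?thesis
      using exit[OF less.prems] unfolding wp_def by (blast intro: exec.Until_exit)
  next
    case False
    then have neg: "rf_value h m < 0" by simp
    obtain m' t' where "exec orc c m m'" "t' < t" "I t' m'"
      using body[OF less.prems neg] unfolding wp_def by blast
    then show ?thesis
      using less.IH[of t' m'] exec.Until_loop[OF neg] unfolding wp_def by blast
  qed
qed


section \<open>Enumerating the candidates\<close>

text \<open>
  A number is read as a list of base 3 digits, least significant first, each of which is an
  instruction to a pen on the real sequence \<open>v\<close>: add the step \<open>h\<close> to the entry at the position \<open>l\<close>,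
  change the step to \<open>- h / 2\<close>, or move on to the next position. Flipping the sign along with the
  halving allows steps of either sign with a single instruction.
\<close>

definition walk_step :: "nat \<Rightarrow> nat \<times> real \<times> (nat \<Rightarrow> real) \<Rightarrow> nat \<times> real \<times> (nat \<Rightarrow> real)" where
  "walk_step d = (\<lambda>(l, h, v).
     if d = 0 then (l, h, v(l := v l + h)) else if d = 1 then (l, - h / 2, v) else (Suc l, h, v))"

function walk :: "nat \<Rightarrow> nat \<times> real \<times> (nat \<Rightarrow> real) \<Rightarrow> nat \<times> real \<times> (nat \<Rightarrow> real)" where
  "walk k s = (if k = 0 then s else walk (k div 3) (walk_step (k mod 3) s))"
  by auto
termination by (relation "inv_image less_than fst") auto

declare walk.simps [simp del]

text \<open>
  The entries with even and odd index are the real and imaginary parts of the coefficients.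
\<close>

definition candidate :: "nat \<Rightarrow> nat \<Rightarrow> real" where
  "candidate k = snd (snd (walk k (0, 1, \<lambda>_. 0)))"

definition candidate_coeff :: "nat \<Rightarrow> nat \<Rightarrow> complex" where
  "candidate_coeff k i = Complex (candidate k (2 * i)) (candidate k (2 * i + 1))"

definition candidate_list :: "nat \<Rightarrow> complex list" where
  "candidate_list k = map (candidate_coeff k) [0..<k]"

text \<open>
  Each instruction at least decreases the remaining number, and one that moves the pen decreases it
  by more than 1, so the pen writes only below \<open>l + k\<close>.
\<close>

lemma walk_unchanged: "i \<ge> l + k \<Longrightarrow> snd (snd (walk k (l, h, v))) i = v i"
proof (induction k arbitrary: l h v rule: less_induct)
  case (less k)
  show ?case
  proof (cases "k = 0")
    case False
    obtain l' h' v' where s: "walk_step (k mod 3) (l, h, v) = (l', h', v')"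
      by (metis prod_cases3)
    have "l' + k div 3 \<le> l + k" "v' i = v i"
      using s less.prems False by (auto simp: walk_step_def split: if_splits)
    then show ?thesis
      using less.IH[of "k div 3" l' h' v'] less.prems False by (subst walk.simps) (simp add: s)
  qed (simp add: walk.simps)
qed

lemma candidate_eq_0: "i \<ge> k \<Longrightarrow> candidate k i = 0"
  using walk_unchanged[of 0 k i] by (simp add: candidate_def)


text \<open>
  Recurrence, not mere occurrence, is needed: the search must be able to meet a vector again at an
  arbitrarily late stage.
\<close>

definition recurs :: "nat \<times> real \<times> (nat \<Rightarrow> real) \<Rightarrow> (nat \<Rightarrow> real) \<Rightarrow> bool" where
  "recurs s w \<longleftrightarrow> (\<forall>N. \<exists>k\<ge>N. snd (snd (walk k s)) = w)"

text \<open>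
  Prefixing the digit \<open>d\<close> turns the number \<open>k\<close> into \<open>3 * k + d\<close>.
\<close>

lemma recurs_walk_step:
  assumes "recurs (walk_step d s) w" "d < 3"
  shows "recurs s w"
  unfolding recurs_def
proof
  fix N
  obtain k where k: "k \<ge> Suc N" "snd (snd (walk k (walk_step d s))) = w"
    using assms(1) unfolding recurs_def by blast
  have "(3 * k + d) div 3 = k" "(3 * k + d) mod 3 = d" "k > 0"
    using assms(2) k(1) by auto
  then have "walk (3 * k + d) s = walk k (walk_step d s)"
    by (subst walk.simps) simp
  then show "\<exists>k\<ge>N. snd (snd (walk k s)) = w"
    using k by (intro exI[of _ "3 * k + d"]) auto
qed

text \<open>
  Arbitrarily many digits 2 only move the pen.
\<close>

lemma recurs_self: "recurs (l, h, v) v"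
  unfolding recurs_def
proof
  show "\<exists>k\<ge>N. snd (snd (walk k (l, h, v))) = v" for N
  proof (induction N arbitrary: l)
    case 0
    show ?case by (intro exI[of _ 0]) (simp add: walk.simps)
  next
    case (Suc N)
    obtain k where k: "k \<ge> N" "snd (snd (walk k (Suc l, h, v))) = v"
      using Suc[of "Suc l"] by blast
    have "(3 * k + 2) div 3 = k" "(3 * k + 2) mod 3 = 2" by presburger+
    then have "walk (3 * k + 2) (l, h, v) = walk k (Suc l, h, v)"
      by (subst walk.simps) (simp add: walk_step_def)
    then show ?case using k by (intro exI[of _ "3 * k + 2"]) auto
  qed
qed

lemma recurs_halve: "recurs (l, h * (- 1 / 2) ^ s, v) w \<Longrightarrow> recurs (l, h, v) w"
proof (induction s arbitrary: h)
  case (Suc s)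
  have "recurs (l, - h / 2, v) w"
    by (rule Suc.IH) (use Suc.prems in \<open>simp add: algebra_simps\<close>)
  then have "recurs (walk_step 1 (l, h, v)) w"
    by (simp add: walk_step_def)
  then show ?case
    by (rule recurs_walk_step) simp
qed simp

lemma recurs_add: "recurs (l, h, v(l := v l + real a * h)) w \<Longrightarrow> recurs (l, h, v) w"
proof (induction a arbitrary: v)
  case (Suc a)
  let ?v = "v(l := v l + h)"
  have "?v(l := ?v l + real a * h) = v(l := v l + real (Suc a) * h)"
    by (simp add: algebra_simps)
  then have "recurs (l, h, ?v) w"
    by (metis Suc.IH Suc.prems)
  then have "recurs (walk_step 0 (l, h, v)) w"
    by (simp add: walk_step_def)
  then show ?case
    by (rule recurs_walk_step) simp
qed simp

text \<open>
  The parity of the number of halvings chooses the sign of the step.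
\<close>

lemma small_signed_step:
  fixes h c \<epsilon> :: real
  assumes "h \<noteq> 0" "\<epsilon> > 0"
  shows "\<exists>s. \<bar>h * (- 1 / 2) ^ s\<bar> < \<epsilon> \<and> h * (- 1 / 2) ^ s * c \<ge> 0"
proof -
  obtain s0 where s0: "(1 / 2 :: real) ^ s0 < \<epsilon> / \<bar>h\<bar>"
    using real_arch_pow_inv[of "\<epsilon> / \<bar>h\<bar>" "1 / 2"] assms by auto
  have small: "\<bar>h * (- 1 / 2) ^ s\<bar> < \<epsilon>" if "s \<ge> s0" for s
  proof -
    have "(1 / 2 :: real) ^ s \<le> (1 / 2) ^ s0" by (rule power_decreasing[OF that]) auto
    then have "(1 / 2 :: real) ^ s < \<epsilon> / \<bar>h\<bar>" using s0 by (rule le_less_trans)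
    then show ?thesis using assms(1) by (simp add: abs_mult power_abs field_simps)
  qed
  have sgn: "h * (- 1 / 2) ^ (2 * s0) * c = h * c * (1 / 4) ^ s0"
    "h * (- 1 / 2) ^ Suc (2 * s0) * c = - (h * c * (1 / 4) ^ s0) / 2"
    by (simp_all add: power_mult power2_eq_square)
  have p: "(1 / 4 :: real) ^ s0 > 0" by simp
  show ?thesis
  proof (cases "h * c \<ge> 0")
    case True
    then have "h * (- 1 / 2) ^ (2 * s0) * c \<ge> 0" unfolding sgn using p by simp
    then show ?thesis using small[of "2 * s0"] by (intro exI[of _ "2 * s0"]) simp
  next
    case False
    then have "h * c \<le> 0" by simp
    then have "h * c * (1 / 4) ^ s0 \<le> 0" by (rule mult_nonpos_nonneg) simp
    then have "h * (- 1 / 2) ^ Suc (2 * s0) * c \<ge> 0" unfolding sgn by linarith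
    then show ?thesis using small[of "Suc (2 * s0)"] by (intro exI[of _ "Suc (2 * s0)"]) simp
  qed
qed

text \<open>
  The entries are treated from left to right: the step is made small and given the direction of the
  target, and then added until the target is less than one step away.
\<close>

lemma recurs_dense:
  fixes t :: "nat \<Rightarrow> real"
  assumes "h \<noteq> 0" "\<epsilon> > 0"
  shows "\<exists>w. recurs (l, h, v) w \<and> (\<forall>i. l \<le> i \<and> i < l + L \<longrightarrow> \<bar>w i - t i\<bar> < \<epsilon>) \<and>
    (\<forall>i. i < l \<or> i \<ge> l + L \<longrightarrow> w i = v i)"
  using assms(1)
proof (induction L arbitrary: l h v)
  case 0
  show ?case by (intro exI[of _ v]) (auto simp: recurs_self)
next
  case (Suc L)
  define c where "c = t l - v l"
  obtain s where s: "\<bar>h * (- 1 / 2) ^ s\<bar> < \<epsilon>" "h * (- 1 / 2) ^ s * c \<ge> 0"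
    using small_signed_step[OF Suc.prems assms(2)] by blast
  define h' where "h' = h * (- 1 / 2) ^ s"
  have h': "h' \<noteq> 0" "\<bar>h'\<bar> < \<epsilon>" "h' * c \<ge> 0" using s Suc.prems by (auto simp: h'_def)
  define a where "a = nat \<lfloor>c / h'\<rfloor>"
  have "c / h' \<ge> 0" using h' by (auto simp: zero_le_divide_iff zero_le_mult_iff)
  then have a: "real a \<le> c / h'" "c / h' < real a + 1"
    by (simp_all add: a_def)
  have "\<bar>real a * h' - c\<bar> = \<bar>h'\<bar> * \<bar>real a - c / h'\<bar>"
    using h'(1) by (simp add: field_simps flip: abs_mult)
  also have "\<dots> \<le> \<bar>h'\<bar>" using a by (intro mult_left_le) auto
  finally have near: "\<bar>v l + real a * h' - t l\<bar> < \<epsilon>" using h'(2) by (simp add: c_def)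
  define v' where "v' = v(l := v l + real a * h')"
  obtain w where w: "recurs (Suc l, h', v') w" "\<forall>i. Suc l \<le> i \<and> i < Suc l + L \<longrightarrow> \<bar>w i - t i\<bar> < \<epsilon>"
    "\<forall>i. i < Suc l \<or> i \<ge> Suc l + L \<longrightarrow> w i = v' i"
    using Suc.IH[OF h'(1), of "Suc l" v'] by blast
  have "recurs (l, h', v') w"
    by (rule recurs_walk_step[of 2]) (use w(1) in \<open>simp_all add: walk_step_def\<close>)
  then have "recurs (l, h, v) w"
    unfolding v'_def by (intro recurs_halve[of l h s] recurs_add[of l _ v a]) (simp add: h'_def)
  moreover have "\<bar>w i - t i\<bar> < \<epsilon>" if "l \<le> i \<and> i < l + Suc L" for i
    using that w(2,3) near by (cases "i = l") (auto simp: v'_def)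
  moreover have "w i = v i" if "i < l \<or> i \<ge> l + Suc L" for i
    using that w(3) by (auto simp: v'_def)
  ultimately show ?case by blast
qed

definition candidate_vector :: "nat \<Rightarrow> ell2" where
  "candidate_vector k = finite_vector (candidate_list k)"

lemma coeff_candidate_vector [simp]: "coeff (candidate_vector k) i = candidate_coeff k i"
  using candidate_eq_0[of k "2 * i"] candidate_eq_0[of k "2 * i + 1"]
  by (auto simp: candidate_vector_def candidate_list_def candidate_coeff_def complex_eq_iff)

lemma candidate_coeff_eq_0: "i \<ge> k \<Longrightarrow> candidate_coeff k i = 0"
  using candidate_eq_0[of k "2 * i"] candidate_eq_0[of k "2 * i + 1"]
  by (auto simp: candidate_coeff_def complex_eq_iff)

lemma candidates_dense:
  fixes c :: "nat \<Rightarrow> complex"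
  assumes "\<epsilon> > 0"
  shows "\<exists>u. (\<forall>N. \<exists>k\<ge>N. candidate_vector k = u) \<and> (\<forall>i\<ge>L. coeff u i = 0) \<and>
    (\<forall>i<L. cmod (coeff u i - c i) < \<epsilon>)"
proof -
  \<comment> \<open>the complex targets, as a list of real and imaginary parts\<close>
  define t where "t i = (if even i then Re (c (i div 2)) else Im (c (i div 2)))" for i
  obtain w where w: "recurs (0, 1, \<lambda>_. 0) w" "\<And>i. i < 2 * L \<Longrightarrow> \<bar>w i - t i\<bar> < \<epsilon> / 2"
    "\<And>i. i \<ge> 2 * L \<Longrightarrow> w i = 0"
    using recurs_dense[of 1 "\<epsilon> / 2" 0 "\<lambda>_. 0" "2 * L" t] assms by auto
  have inf: "\<exists>k\<ge>N. candidate k = w" for N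
    using w(1) by (simp add: recurs_def candidate_def)
  have coeff: "coeff (candidate_vector k) i = Complex (w (2 * i)) (w (2 * i + 1))" if "candidate k = w" for k i
    using that by (simp add: candidate_coeff_def)
  obtain k0 where k0: "candidate k0 = w" using inf by blast
  show ?thesis
  proof (intro exI[of _ "candidate_vector k0"] conjI allI impI)
    fix N
    obtain k where "k \<ge> N" "candidate k = w" using inf by blast
    then show "\<exists>k\<ge>N. candidate_vector k = candidate_vector k0"
      using coeff k0 by (intro exI[of _ k]) (auto intro: ell2_eqI simp del: coeff_candidate_vector)
  next
    fix i assume "i \<ge> L"
    then show "coeff (candidate_vector k0) i = 0"
      unfolding coeff[OF k0] by (simp add: w(3) complex_eq_iff)
  next
    fix i assume "i < L"
    then have "\<bar>w (2 * i) - Re (c i)\<bar> < \<epsilon> / 2" "\<bar>w (2 * i + 1) - Im (c i)\<bar> < \<epsilon> / 2"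
      using w(2)[of "2 * i"] w(2)[of "2 * i + 1"] by (auto simp: t_def)
    then show "cmod (coeff (candidate_vector k0) i - c i) < \<epsilon>"
      unfolding coeff[OF k0]
      using cmod_le[of "Complex (w (2 * i)) (w (2 * i + 1)) - c i"] by simp
  qed
qed


section \<open>The program\<close>

text \<open>
  The rate \<open>\<alpha> n + \<beta> n\<close> is the tolerance wherever it is positive; \<open>1 / n\<close> keeps the search finite and
  the results convergent elsewhere.
\<close>

definition tolerance :: "(nat \<Rightarrow> real) \<Rightarrow> (nat \<Rightarrow> real) \<Rightarrow> nat \<Rightarrow> real" where
  "tolerance \<alpha> \<beta> n = (if \<alpha> n + \<beta> n > 0 then \<alpha> n + \<beta> n else 1 / real n)"

text \<open>
  The machine starts with \<open>n\<close> in cell 0, and cell 1 belongs to the counting loops. The remaining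
  scalars have fixed cells below 32; the real entries of the current candidate are stored from cell
  32 on, in the format of the output.
\<close>

abbreviation (input) "cell_n \<equiv> 0 :: nat"
abbreviation (input) "cell_zr \<equiv> 2 :: nat"
abbreviation (input) "cell_zi \<equiv> 3 :: nat"
abbreviation (input) "cell_k \<equiv> 4 :: nat"
abbreviation (input) "cell_tol \<equiv> 5 :: nat"
abbreviation (input) "cell_re \<equiv> 6 :: nat"
abbreviation (input) "cell_im \<equiv> 7 :: nat"
abbreviation (input) "cell_pos \<equiv> 8 :: nat"
abbreviation (input) "cell_step \<equiv> 9 :: nat"
abbreviation (input) "cell_rest \<equiv> 10 :: nat"
abbreviation (input) "cell_quot \<equiv> 11 :: nat"
abbreviation (input) "cell_i \<equiv> 12 :: nat"
abbreviation (input) "cell_j \<equiv> 13 :: nat"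
abbreviation (input) "cell_rr \<equiv> 14 :: nat"
abbreviation (input) "cell_ri \<equiv> 15 :: nat"
abbreviation (input) "cell_defect \<equiv> 16 :: nat"
abbreviation (input) "cell_len \<equiv> 17 :: nat"
abbreviation (input) "cell_weight \<equiv> 18 :: nat"
abbreviation (input) "cell_yr \<equiv> 19 :: nat"
abbreviation (input) "cell_yi \<equiv> 20 :: nat"

text \<open>
  The range is \<open>2 * f k\<close> because evaluating the residual in row \<open>i < f k\<close> reads the entry of the candidate
  with that index, also where \<open>k \<le> i\<close>.
\<close>

definition clear_vector :: "'q prog" where
  "clear_vector =
     Assign cell_i (Const 0) ;;
     Until (Minus (Cell cell_i) (Times (Const 2) (Cell cell_len)))
      (Assign cell_re (Const 0) ;;
       Store (Plus (Const 32) (Cell cell_i)) cell_re ;;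
       Assign cell_i (Plus (Cell cell_i) (Const 1)))"

text \<open>
  A machine node has no integer division; quotient and remainder come from repeated subtraction.
\<close>

definition divide_by_3 :: "'q prog" where
  "divide_by_3 =
     Assign cell_quot (Const 0) ;;
     Until (Minus (Const 2) (Cell cell_rest))
      (Assign cell_rest (Minus (Cell cell_rest) (Const 3)) ;;
       Assign cell_quot (Plus (Cell cell_quot) (Const 1)))"

definition take_step :: "'q prog" where
  "take_step =
     Cond (Minus (Const 0) (Cell cell_rest))
      (Load cell_re (Plus (Const 32) (Cell cell_pos)) ;;
       Assign cell_re (Plus (Cell cell_re) (Cell cell_step)) ;;
       Store (Plus (Const 32) (Cell cell_pos)) cell_re)
      (Cond (Minus (Const 1) (Cell cell_rest))
        (Assign cell_step (Divide (Cell cell_step) (Const (- 2))))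
        (Assign cell_pos (Plus (Cell cell_pos) (Const 1))))"

definition build_candidate :: "'q prog" where
  "build_candidate =
     clear_vector ;;
     Assign cell_pos (Const 0) ;; Assign cell_step (Const 1) ;; Assign cell_rest (Cell cell_k) ;;
     Until (Minus (Const 0) (Cell cell_rest))
      (divide_by_3 ;; take_step ;; Assign cell_rest (Cell cell_quot))"

definition load_entry :: "nat \<Rightarrow> 'q prog" where
  "load_entry c =
     Load cell_yr (Plus (Const 32) (Times (Const 2) (Cell c))) ;;
     Load cell_yi (Plus (Const 33) (Times (Const 2) (Cell c)))"

definition square_sum :: "nat \<Rightarrow> nat \<Rightarrow> rational_function" where
  "square_sum a b = Plus (Times (Cell a) (Cell a)) (Times (Cell b) (Cell b))"

text \<open>
  Row \<open>i\<close> of \<open>(T - z) y - x\<close> is accumulated in the cells \<open>cell_rr\<close> and \<open>cell_ri\<close>, starting with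
  \<open>- x\<^sub>i - z y\<^sub>i\<close>. The weighted square of \<open>y\<^sub>i\<close> is added to the defect while \<open>y\<^sub>i\<close> is at hand.
\<close>

definition residual_row :: "query prog" where
  "residual_row =
     Ask Coefficient (Cell cell_i) (Const 0) cell_rr cell_ri ;;
     load_entry cell_i ;;
     Assign cell_defect (Plus (Cell cell_defect)
       (Times (Cell cell_weight) (square_sum cell_yr cell_yi))) ;;
     Assign cell_rr (Minus (Minus (Const 0) (Cell cell_rr))
       (Minus (Times (Cell cell_zr) (Cell cell_yr)) (Times (Cell cell_zi) (Cell cell_yi)))) ;;
     Assign cell_ri (Minus (Minus (Const 0) (Cell cell_ri))
       (Plus (Times (Cell cell_zr) (Cell cell_yi)) (Times (Cell cell_zi) (Cell cell_yr)))) ;;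
     Assign cell_j (Const 0) ;;
     Until (Minus (Cell cell_j) (Cell cell_k))
      (Ask Entry (Cell cell_i) (Cell cell_j) cell_re cell_im ;;
       load_entry cell_j ;;
       Assign cell_rr (Plus (Cell cell_rr)
         (Minus (Times (Cell cell_re) (Cell cell_yr)) (Times (Cell cell_im) (Cell cell_yi)))) ;;
       Assign cell_ri (Plus (Cell cell_ri)
         (Plus (Times (Cell cell_re) (Cell cell_yi)) (Times (Cell cell_im) (Cell cell_yr)))) ;;
       Assign cell_j (Plus (Cell cell_j) (Const 1)))"

definition evaluate_candidate :: "query prog" where
  "evaluate_candidate =
     Ask Beta_value (Cell cell_k) (Const 0) cell_re cell_im ;;
     Assign cell_defect (Times (Cell cell_re) (Cell cell_re)) ;;
     Assign cell_i (Const 0) ;;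
     Until (Minus (Cell cell_i) (Cell cell_len))
      (residual_row ;;
       Assign cell_defect (Plus (Cell cell_defect) (square_sum cell_rr cell_ri)) ;;
       Assign cell_i (Plus (Cell cell_i) (Const 1)))"

definition set_tolerance :: "query prog" where
  "set_tolerance =
     Ask Alpha_value (Cell cell_n) (Const 0) cell_tol cell_im ;;
     Ask Beta_value (Cell cell_n) (Const 0) cell_re cell_im ;;
     Assign cell_tol (Plus (Cell cell_tol) (Cell cell_re)) ;;
     Cond (Minus (Const 0) (Cell cell_tol))
      (Assign cell_tol (Divide (Const 1) (Cell cell_n)))
      (Assign cell_tol (Cell cell_tol))"

definition next_candidate :: "query prog" where
  "next_candidate =
     Assign cell_k (Plus (Cell cell_k) (Const 1)) ;;
     Ask F_value (Cell cell_k) (Const 0) cell_len cell_im ;;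
     Ask Alpha_value (Cell cell_k) (Const 0) cell_re cell_im ;;
     Assign cell_weight (Plus (Times (Cell cell_re) (Cell cell_re)) (Divide (Const 1) (Cell cell_k))) ;;
     build_candidate ;;
     evaluate_candidate"

text \<open>
  The initial value of the defect lies above the threshold, so that the first candidate is built
  before the first proper test; \<open>next_candidate\<close> begins by increasing \<open>k\<close>, which therefore starts at
  \<open>n - 1\<close>.
\<close>

definition search :: "query prog" where
  "search =
     set_tolerance ;;
     Assign cell_k (Minus (Cell cell_n) (Const 1)) ;;
     Assign cell_defect (Plus (Times (Cell cell_tol) (Cell cell_tol)) (Const 1)) ;;
     Until (Minus (Times (Cell cell_tol) (Cell cell_tol)) (Cell cell_defect)) next_candidate"

text \<open>
  The opening query for \<open>z\<close> makes the set of evaluations nonempty; the closing loops point the address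
  registers to the output and its length.
\<close>

definition machine :: "query bss_node list" where
  "machine =
     (let C = compile 1 search
      in Query Point cell_zr cell_zi # C @ count_addrs (1 + length C) (Const 32) (Cell cell_k))"

text \<open>
  The squared certificate: up to constants, bounds for the part of the residual that no finite
  computation sees, and the square of the part in the first \<open>f k\<close> rows. The weight \<open>1 / k\<close> limits the
  norm of an accepted candidate in terms of \<open>k\<close> and the tolerance, whatever \<open>z\<close> is.
\<close>

definition defect :: "(nat \<Rightarrow> nat) \<Rightarrow> (nat \<Rightarrow> real) \<Rightarrow> (nat \<Rightarrow> real) \<Rightarrow> operator \<Rightarrow> ell2 \<Rightarrow> complex \<Rightarrow> nat \<Rightarrow> real" where
  "defect f \<alpha> \<beta> T x z k = (\<beta> k)\<^sup>2 + (\<Sum>i<f k.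
     ((\<alpha> k)\<^sup>2 + 1 / real k) * (cmod (candidate_coeff k i))\<^sup>2 +
     (cmod ((\<Sum>j<k. coeff (the (T (basis j))) i * candidate_coeff k j)
        - z * candidate_coeff k i - coeff x i))\<^sup>2)"


section \<open>Correctness of the program\<close>

locale resolvent_search =
  fixes f :: "nat \<Rightarrow> nat" and \<alpha> \<beta> :: "nat \<Rightarrow> real" and T :: operator and x :: ell2 and z :: complex
    and n :: nat
  assumes f_gt: "k \<ge> 1 \<Longrightarrow> f k > k" and n_pos: "n \<ge> 1"
begin

abbreviation orc :: "query oracle_function" where
  "orc \<equiv> \<lambda>q i j. evaluation f \<alpha> \<beta> q i j ((T, x), z)"

text \<open>
  \<open>inputs\<close> describes the cells that persist during the search, \<open>stage\<close> those that persist while one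
  candidate is treated.
\<close>

definition inputs :: "nat \<Rightarrow> (nat \<Rightarrow> real) \<Rightarrow> bool" where
  "inputs k m \<longleftrightarrow> m cell_n = real n \<and> m 1 = 0 \<and> m cell_zr = Re z \<and> m cell_zi = Im z \<and>
     m cell_tol = tolerance \<alpha> \<beta> n \<and> m cell_k = real k"

definition stage :: "nat \<Rightarrow> (nat \<Rightarrow> real) \<Rightarrow> bool" where
  "stage k m \<longleftrightarrow> inputs k m \<and> m cell_len = real (f k) \<and> m cell_weight = (\<alpha> k)\<^sup>2 + 1 / real k"

definition stores :: "nat \<Rightarrow> (nat \<Rightarrow> real) \<Rightarrow> (nat \<Rightarrow> real) \<Rightarrow> bool" where
  "stores k v m \<longleftrightarrow> (\<forall>i<2 * f k. m (32 + i) = v i)"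

lemmas state_defs = inputs_def stage_def stores_def

lemma clear_vector_correct:
  assumes "stage k m"
  shows "wp orc clear_vector (\<lambda>m'. stage k m' \<and> stores k (\<lambda>_. 0) m') m"
  unfolding clear_vector_def
  apply (rule wp_Seq wp_Assign)+
  apply (rule wp_Until[where I = "\<lambda>t m. \<exists>i. t + i = 2 * f k \<and> stage k m \<and> m cell_i = real i \<and>
      (\<forall>j<i. m (32 + j) = 0)" and t = "2 * f k"])
  subgoal using assms by (auto simp: state_defs)
  subgoal for t m
    apply clarify
    subgoal for i
      apply (rule wp_Seq wp_Assign)+
      apply (rule wp_Store[where a = "32 + i"])
        apply (simp add: state_defs)
       apply simp
      apply (rule wp_Assign)
      apply (rule exI[of _ "t - 1"])
      apply (auto simp: state_defs less_Suc_eq intro!: exI[of _ "Suc i"])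
      done
    done
  subgoal for t m by (auto simp: stage_def inputs_def stores_def)
  done

lemma divide_by_3_correct:
  assumes "m cell_rest = real r"
  shows "wp orc divide_by_3 (\<lambda>m'. m' = m(cell_quot := real (r div 3), cell_rest := real (r mod 3))) m"
  unfolding divide_by_3_def
  apply (rule wp_Seq wp_Assign)+
  apply (rule wp_Until[where I = "\<lambda>t m'. \<exists>q. r = 3 * q + t \<and>
      m' = m(cell_quot := real q, cell_rest := real t)" and t = r])
  subgoal using assms by auto
  subgoal for t m'
    apply clarify
    subgoal for q
      apply (rule wp_Seq wp_Assign)+
      apply (rule exI[of _ "t - 3"])
      apply (auto simp: fun_eq_iff intro!: exI[of _ "Suc q"])
      done
    done
  subgoal for t m' by (auto simp: fun_eq_iff)
  done


lemma take_step_correct: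
  assumes m: "stage k m" "stores k v m" "m cell_pos = real l" "m cell_step = h" "m cell_rest = real d"
    and l: "l < 2 * f k" and step: "walk_step d (l, h, v) = (l', h', v')"
  shows "wp orc take_step (\<lambda>m'. stage k m' \<and> stores k v' m' \<and> m' cell_pos = real l' \<and>
    m' cell_step = h' \<and> m' cell_quot = m cell_quot) m"
  unfolding take_step_def
  apply (rule wp_Cond)
  subgoal
    apply (rule wp_Seq)
    apply (rule wp_Load[where a = "32 + l"])
    subgoal using m by (simp add: state_defs)
    subgoal using m by simp
    apply (rule wp_Seq wp_Assign)+
    apply (rule wp_Store[where a = "32 + l"])
    subgoal using m by (simp add: state_defs)
    subgoal using m by simp
    subgoal using m l step by (auto simp: state_defs walk_step_def)
    done
  subgoal
    apply (rule wp_Cond)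
    subgoal
      apply (rule wp_Assign)
      using m step by (auto simp: state_defs walk_step_def of_rat_minus split: if_splits)
    subgoal
      apply (rule wp_Assign)
      using m step by (auto simp: state_defs walk_step_def split: if_splits)
    done
  done

lemma build_candidate_correct:
  assumes "stage k m" "k \<ge> 1"
  shows "wp orc build_candidate (\<lambda>m'. stage k m' \<and> stores k (candidate k) m') m"
  unfolding build_candidate_def
  apply (rule wp_Seq, rule wp_mono[OF clear_vector_correct[OF assms(1)]], erule conjE)
  apply (rule wp_Seq wp_Assign)+
  \<comment> \<open>following the remaining digits from the present state still ends at the candidate\<close>
  apply (rule wp_Until[where t = k and I = "\<lambda>r m. \<exists>l v. walk k (0, 1, \<lambda>_. 0) = walk r (l, m cell_step, v) \<and>
      l + r \<le> k \<and> stage k m \<and> stores k v m \<and> m cell_pos = real l \<and> m cell_rest = real r"])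
  subgoal by (rule exI[of _ 0], rule exI[of _ "\<lambda>_. 0"]) (auto simp: state_defs)
  subgoal for m0 r m
    apply clarify
    subgoal premises p for l v
    proof -
      define h where "h = m cell_step"
      have r: "r > 0" using p by simp
      obtain l' h' v' where s: "walk_step (r mod 3) (l, h, v) = (l', h', v')"
        by (metis prod_cases3)
      have l': "l' + r div 3 \<le> l + r"
        using s r by (auto simp: walk_step_def split: if_splits)
      have walk: "walk (r div 3) (l', h', v') = walk k (0, 1, \<lambda>_. 0)"
      proof -
        have "walk r (l, h, v) = walk k (0, 1, \<lambda>_. 0)" using p by (simp add: h_def)
        then show ?thesis using r walk.simps[of r "(l, h, v)"] by (simp add: s)
      qed
      have lk: "l < 2 * f k" using p r f_gt[OF assms(2)] by simp
      let ?m = "m(cell_quot := real (r div 3), cell_rest := real (r mod 3))"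
      have ts: "wp orc take_step (\<lambda>m'. stage k m' \<and> stores k v' m' \<and> m' cell_pos = real l' \<and>
          m' cell_step = h' \<and> m' cell_quot = ?m cell_quot) ?m"
        by (rule take_step_correct[where d = "r mod 3" and l = l and h = h and v = v])
          (use p s lk in \<open>auto simp: state_defs h_def\<close>)
      show ?thesis
        apply (rule wp_Seq, rule wp_mono[OF divide_by_3_correct[of m r]])
        subgoal using p by simp
        apply (erule ssubst, rule wp_Seq, rule wp_mono[OF ts], rule wp_Assign)
        apply (rule exI[of _ "r div 3"])
        using r l' walk p
        apply (auto simp: state_defs intro!: exI[of _ l'] exI[of _ v'])
        done
    qed
    done
  subgoal for m0 r m
    by (auto simp: candidate_def walk.simps[of 0])
  done

lemma stores_candidateD:
  assumes "stores k (candidate k) m" "i < f k"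
  shows "m (32 + 2 * i) = Re (candidate_coeff k i)" "m (33 + 2 * i) = Im (candidate_coeff k i)"
  using assms(1)[unfolded stores_def, rule_format, of "2 * i"]
    assms(1)[unfolded stores_def, rule_format, of "2 * i + 1"] assms(2)
  by (simp_all add: candidate_coeff_def)

lemma wp_load_entry:
  assumes "stage k m" "stores k (candidate k) m" "m c = real i" "i < f k" "c \<noteq> cell_yr"
    and Q: "Q (m(cell_yr := Re (candidate_coeff k i), cell_yi := Im (candidate_coeff k i)))"
  shows "wp orc (load_entry c) Q m"
proof -
  note y = stores_candidateD[OF assms(2,4)]
  show ?thesis
    unfolding load_entry_def
    apply (rule wp_Seq)
    apply (rule wp_Load[where a = "32 + 2 * i"])
    subgoal using assms by (simp add: state_defs)
    subgoal using assms by simp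
    apply (rule wp_Load[where a = "33 + 2 * i"])
    subgoal using assms by (simp add: state_defs)
    subgoal using assms by simp
    subgoal using Q by (simp add: y)
    done
qed

definition residual :: "nat \<Rightarrow> nat \<Rightarrow> nat \<Rightarrow> complex" where
  "residual k t i = (\<Sum>j<t. coeff (the (T (basis j))) i * candidate_coeff k j)
     - z * candidate_coeff k i - coeff x i"

lemma residual_Suc:
  "residual k (Suc t) i = residual k t i + coeff (the (T (basis t))) i * candidate_coeff k t"
  by (simp add: residual_def)

lemma Re_Im_squares: "Re w * Re w + Im w * Im w = (cmod w)\<^sup>2"
  by (simp add: cmod_power2 flip: power2_eq_square)

lemma residual_row_correct:
  assumes m: "stage k m" "stores k (candidate k) m" "m cell_i = real i" and i: "i < f k" and k: "k \<ge> 1"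
  shows "wp orc residual_row (\<lambda>m'. stage k m' \<and> stores k (candidate k) m' \<and> m' cell_i = real i \<and>
    m' cell_defect = m cell_defect + ((\<alpha> k)\<^sup>2 + 1 / real k) * (cmod (candidate_coeff k i))\<^sup>2 \<and>
    m' cell_rr = Re (residual k k i) \<and> m' cell_ri = Im (residual k k i)) m"
  unfolding residual_row_def
  apply (rule wp_Seq)
  apply (rule wp_Ask[where i = i and j = 0])
  subgoal using m by (simp add: state_defs)
  subgoal using m by simp
  subgoal by simp
  apply (rule wp_Seq)
  apply (rule wp_load_entry[where k = k and i = i])
  subgoal using m by (simp add: state_defs)
  subgoal using m by (simp add: state_defs)
  subgoal using m by simp
  subgoal by (rule i)
  subgoal by simp
  apply (rule wp_Seq wp_Assign)+
  apply (rule wp_Until[where t = k and I = "\<lambda>t m'. \<exists>j. j + t = k \<and> m' cell_j = real j \<and>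
      stage k m' \<and> stores k (candidate k) m' \<and> m' cell_i = real i \<and>
      m' cell_defect = m cell_defect + ((\<alpha> k)\<^sup>2 + 1 / real k) * (cmod (candidate_coeff k i))\<^sup>2 \<and>
      m' cell_rr = Re (residual k j i) \<and> m' cell_ri = Im (residual k j i)"])
  subgoal using m by (simp add: state_defs residual_def square_sum_def Re_Im_squares)
  subgoal for t m'
    apply clarify
    subgoal for j
      apply (rule wp_Seq)
      apply (rule wp_Ask[where i = i and j = j])
      subgoal by (simp add: state_defs)
      subgoal by simp
      subgoal by simp
      apply (rule wp_Seq)
      apply (rule wp_load_entry[where k = k and i = j])
      subgoal by (simp add: state_defs)
      subgoal by (simp add: state_defs)
      subgoal by simp
      subgoal using f_gt[OF k] by simp
      subgoal by simp
      apply (rule wp_Seq wp_Assign)+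
      apply (rule exI[of _ "t - 1"])
      apply (auto simp: state_defs residual_Suc intro!: exI[of _ "Suc j"])
      done
    done
  subgoal for t m' by (auto simp: state_defs)
  done

lemma evaluate_candidate_correct:
  assumes m: "stage k m" "stores k (candidate k) m" and k: "k \<ge> 1"
  shows "wp orc evaluate_candidate (\<lambda>m'. stage k m' \<and> stores k (candidate k) m' \<and>
    m' cell_defect = defect f \<alpha> \<beta> T x z k) m"
proof -
  define D where "D i = (\<beta> k)\<^sup>2 + (\<Sum>l<i. ((\<alpha> k)\<^sup>2 + 1 / real k) * (cmod (candidate_coeff k l))\<^sup>2 +
     (cmod (residual k k l))\<^sup>2)" for i
  show ?thesis
    unfolding evaluate_candidate_def
    apply (rule wp_Seq)
    apply (rule wp_Ask[where i = k and j = 0])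
    subgoal using m by (simp add: state_defs)
    subgoal using m by (simp add: state_defs)
    subgoal by simp
    apply (rule wp_Seq wp_Assign)+
    apply (rule wp_Until[where t = "f k" and I = "\<lambda>t m'. \<exists>i. i + t = f k \<and> m' cell_i = real i \<and>
        stage k m' \<and> stores k (candidate k) m' \<and> m' cell_defect = D i"])
    subgoal using m by (simp add: state_defs D_def power2_eq_square)
    subgoal for t m'
      apply clarify
      subgoal for i
        apply (rule wp_Seq)
        apply (rule wp_mono[OF residual_row_correct[where k = k and i = i]])
        apply assumption+
        subgoal by (simp add: state_defs)
        subgoal by (rule k)
        apply (rule wp_Seq wp_Assign)+
        apply (rule exI[of _ "t - 1"])
        apply (auto simp: state_defs D_def square_sum_def Re_Im_squares intro!: exI[of _ "Suc i"])
        done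
      done
    subgoal for t m'
      apply clarify
      subgoal premises p for i
      proof -
        have "i = f k" using p by (simp add: stage_def)
        then show ?thesis using p by (simp add: D_def defect_def residual_def)
      qed
      done
    done
qed

lemma next_candidate_correct:
  assumes "inputs k m"
  shows "wp orc next_candidate (\<lambda>m'. inputs (Suc k) m' \<and> stores (Suc k) (candidate (Suc k)) m' \<and>
    m' cell_defect = defect f \<alpha> \<beta> T x z (Suc k)) m"
  unfolding next_candidate_def
  apply (rule wp_Seq wp_Assign)+
  apply (rule wp_Ask[where i = "Suc k" and j = 0])
  subgoal using assms by (simp add: inputs_def)
  subgoal using assms by (simp add: inputs_def)
  subgoal by simp
  apply (rule wp_Seq)
  apply (rule wp_Ask[where i = "Suc k" and j = 0])
  subgoal using assms by (simp add: inputs_def)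
  subgoal using assms by (simp add: inputs_def)
  subgoal by simp
  apply (rule wp_Seq wp_Assign)+
  apply (rule wp_mono[OF build_candidate_correct[where k = "Suc k"]])
  subgoal using assms by (simp add: stage_def inputs_def power2_eq_square add.commute)
  subgoal by simp
  apply (erule conjE, rule wp_mono[OF evaluate_candidate_correct[where k = "Suc k"]])
     apply (auto simp: stage_def)
  done

lemma set_tolerance_correct:
  assumes "m cell_n = real n" "m 1 = 0"
  shows "wp orc set_tolerance (\<lambda>m'. m' cell_n = m cell_n \<and> m' 1 = 0 \<and> m' cell_zr = m cell_zr \<and>
    m' cell_zi = m cell_zi \<and> m' cell_tol = tolerance \<alpha> \<beta> n) m"
  unfolding set_tolerance_def
  apply (rule wp_Seq)
  apply (rule wp_Ask[where i = n and j = 0])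
  subgoal using assms by simp
  subgoal using assms by simp
  subgoal by simp
  apply (rule wp_Seq)
  apply (rule wp_Ask[where i = n and j = 0])
  subgoal using assms by simp
  subgoal using assms by simp
  subgoal by simp
  apply (rule wp_Seq wp_Assign)+
  apply (rule wp_Cond; rule wp_Assign)
  subgoal using assms by (simp add: tolerance_def)
  subgoal using assms by (simp add: tolerance_def)
  done

lemma search_correct:
  assumes m: "m cell_n = real n" "m 1 = 0" "m cell_zr = Re z" "m cell_zi = Im z"
    and K: "K \<ge> n" "defect f \<alpha> \<beta> T x z K \<le> (tolerance \<alpha> \<beta> n)\<^sup>2"
  shows "wp orc search (\<lambda>m'. \<exists>k\<ge>n. defect f \<alpha> \<beta> T x z k \<le> (tolerance \<alpha> \<beta> n)\<^sup>2 \<and>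
    inputs k m' \<and> stores k (candidate k) m') m"
  unfolding search_def
  apply (rule wp_Seq, rule wp_mono[OF set_tolerance_correct[OF m(1,2)]])
  apply (rule wp_Seq wp_Assign)+
  \<comment> \<open>the known success at \<open>K\<close> bounds the number of rounds; the search may stop earlier\<close>
  apply (rule wp_Until[where t = "K - (n - 1)" and I = "\<lambda>t m'. \<exists>k. k + t = K \<and> inputs k m' \<and>
     (k = n - 1 \<and> m' cell_defect = (tolerance \<alpha> \<beta> n)\<^sup>2 + 1 \<or>
      k \<ge> n \<and> m' cell_defect = defect f \<alpha> \<beta> T x z k \<and> stores k (candidate k) m')"])
  subgoal using m K n_pos
    by (intro exI[of _ "n - 1"]) (auto simp: inputs_def power2_eq_square of_nat_diff)
  subgoal for m0 t m'
    apply clarify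
    subgoal premises p for k
    proof -
      have "t \<noteq> 0"
      proof
        assume "t = 0"
        then show False
          using p K n_pos by (auto simp: inputs_def power2_eq_square)
      qed
      moreover have "inputs k m'" using p by blast
      ultimately show ?thesis
        using p n_pos
        by (intro wp_mono[OF next_candidate_correct[of k m']] exI[of _ "t - 1"] conjI[OF _ exI[of _ "Suc k"]])
          auto
    qed
    done
  subgoal for m0 t m'
    by (auto simp: inputs_def power2_eq_square)
  done

lemma machine_correct:
  assumes K: "K \<ge> n" "defect f \<alpha> \<beta> T x z K \<le> (tolerance \<alpha> \<beta> n)\<^sup>2"
  shows "\<exists>k\<ge>n. defect f \<alpha> \<beta> T x z k \<le> (tolerance \<alpha> \<beta> n)\<^sup>2 \<and>
    bss_computes machine orc n (candidate_list k)"
proof -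
  define C where "C = compile 1 search"
  let ?m0 = "(\<lambda>_. 0 :: real)(0 := real n)"
  let ?m = "?m0(cell_zr := Re z, cell_zi := Im z)"
  have P: "machine = [Query Point cell_zr cell_zi] @ C @ count_addrs (1 + length C) (Const 32) (Cell cell_k)"
    by (simp add: machine_def C_def Let_def)
  have len: "length machine = 1 + length C + 12" by (simp add: P)
  have "code_at machine 0 machine" by (auto simp: code_at_def)
  note subst[OF P, of "code_at machine 0", OF this]
  then have code: "code_at machine 1 (compile 1 search)"
    "code_at machine (1 + length C) (count_addrs (1 + length C) (Const 32) (Cell cell_k))"
    unfolding code_at_append by (simp_all add: C_def)
  have "wp orc search (\<lambda>m'. \<exists>k\<ge>n. defect f \<alpha> \<beta> T x z k \<le> (tolerance \<alpha> \<beta> n)\<^sup>2 \<and>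
    inputs k m' \<and> stores k (candidate k) m') ?m"
    by (rule search_correct[OF _ _ _ _ K]) simp_all
  then obtain m' k where ex: "exec orc search ?m m'" and k: "k \<ge> n"
    "defect f \<alpha> \<beta> T x z k \<le> (tolerance \<alpha> \<beta> n)\<^sup>2" "inputs k m'" "stores k (candidate k) m'"
    unfolding wp_def by blast
  obtain a b where r: "reaches machine orc (State 1 0 0 ?m) (State (1 + length C) a b m')"
    using compile_correct[OF ex code(1), of 0 0] unfolding C_def by blast
  have "reaches machine orc (bss_init n) (State 1 0 0 ?m)"
    by (rule reaches_1) (simp add: bss_step_def bss_init_def P)
  also note r
  also have "reaches machine orc (State (1 + length C) a b m') (State (1 + length C + 12) 32 k m')"
    by (rule reaches_count_addrs[OF code(2)]) (use k in \<open>simp_all add: inputs_def\<close>)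
  finally obtain t where t: "bss_run machine orc n t = State (1 + length C + 12) 32 k m'"
    by (auto simp: reaches_def bss_run_def)
  have "k < f k" using f_gt n_pos k(1) by simp
  then have "bss_output (State (1 + length C + 12) 32 k m') = candidate_list k"
    using stores_candidateD[OF k(4)] by (auto simp: bss_output_def candidate_list_def)
  then have "bss_computes machine orc n (candidate_list k)"
    unfolding bss_computes_def by (intro exI[of _ t]) (simp add: t len)
  then show ?thesis using k by blast
qed

end


section \<open>The defect controls the residual and becomes small\<close>

text \<open>
  The core puts the basis vectors into the domain, so on finitely supported vectors \<open>T\<close> is given by its
  columns.
\<close>

lemma Omega_SA_combination:
  assumes T: "T \<in> Omega_SA"
  shows "(\<Sum>j<N. c j *\<^sub>C basis j) \<in> dom T"
    and "the (T (\<Sum>j<N. c j *\<^sub>C basis j)) = (\<Sum>j<N. c j *\<^sub>C the (T (basis j)))"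
proof -
  have lin: "linear_operator T" and sub: "ell2.span (range basis) \<subseteq> dom T"
    using T by (auto simp: Omega_SA_def self_adjoint_def is_core_def)
  have subspace: "ell2.subspace (dom T)" using lin by (simp add: linear_operator_def)
  have b: "basis j \<in> dom T" for j using sub ell2.span_base[of "basis j" "range basis"] by auto
  have s: "c j *\<^sub>C basis j \<in> dom T" for j using ell2.subspace_scale[OF subspace b] .
  show dom: "(\<Sum>j<N. c j *\<^sub>C basis j) \<in> dom T" for N
    using ell2.subspace_sum[OF subspace s] .
  show "the (T (\<Sum>j<N. c j *\<^sub>C basis j)) = (\<Sum>j<N. c j *\<^sub>C the (T (basis j)))"
  proof (induction N)
    case 0
    have "the (T (0 *\<^sub>C basis 0)) = 0 *\<^sub>C the (T (basis 0))"
      using lin b unfolding linear_operator_def by blast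
    then show ?case by simp
  next
    case (Suc N)
    have "the (T ((\<Sum>j<N. c j *\<^sub>C basis j) + c N *\<^sub>C basis N)) =
        the (T (\<Sum>j<N. c j *\<^sub>C basis j)) + the (T (c N *\<^sub>C basis N))"
      using lin dom s unfolding linear_operator_def by blast
    moreover have "the (T (c N *\<^sub>C basis N)) = c N *\<^sub>C the (T (basis N))"
      using lin b unfolding linear_operator_def by blast
    ultimately show ?case using Suc by simp
  qed
qed

lemma finite_support_expansion:
  assumes "\<And>i. i \<ge> N \<Longrightarrow> coeff y i = 0"
  shows "y = (\<Sum>j<N. coeff y j *\<^sub>C basis j)"
proof (rule ell2_eqI)
  fix k
  have "(\<Sum>j<N. coeff y j * (if k = j then 1 else 0)) = (\<Sum>j<N. if k = j then coeff y j else 0)"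
    by (rule sum.cong) auto
  then show "coeff y k = coeff (\<Sum>j<N. coeff y j *\<^sub>C basis j) k"
    using assms[of k] by auto
qed

lemma Omega_SA_finite_support:
  assumes T: "T \<in> Omega_SA" and y: "\<And>i. i \<ge> N \<Longrightarrow> coeff y i = 0"
  shows "y \<in> dom T" and "the (T y) = (\<Sum>j<N. coeff y j *\<^sub>C the (T (basis j)))"
  using Omega_SA_combination[OF T, of "coeff y" N] finite_support_expansion[of N y] y by auto

text \<open>
  The part of the residual that the defect sees is the projection to the first \<open>f k\<close> rows.
\<close>

lemma defect_eq:
  assumes T: "T \<in> Omega_SA" and k: "k < f k"
  shows "defect f \<alpha> \<beta> T x z k = (\<beta> k)\<^sup>2 + ((\<alpha> k)\<^sup>2 + 1 / real k) * (norm (candidate_vector k))\<^sup>2 +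
    (norm (proj (f k) (the (T (candidate_vector k)) - z *\<^sub>C candidate_vector k - x)))\<^sup>2"
proof -
  have "(norm (candidate_vector k))\<^sup>2 = (\<Sum>i<f k. (cmod (candidate_coeff k i))\<^sup>2)"
    by (subst norm_finite_ell2[of "f k"]) (use k in \<open>auto simp: candidate_coeff_eq_0\<close>)
  moreover have "coeff (the (T (candidate_vector k))) i
      = (\<Sum>j<k. coeff (the (T (basis j))) i * candidate_coeff k j)" for i
    using Omega_SA_finite_support(2)[OF T, of k "candidate_vector k"]
    by (simp add: candidate_coeff_eq_0 mult.commute)
  ultimately show ?thesis
    by (simp add: defect_def norm_proj_squared sum.distrib sum_distrib_left)
qed

text \<open>
  An \<open>onorm\<close> bounds only a bounded operator, which this one is because it has finite rank.
\<close>

lemma off_norm_bound: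
  assumes T: "T \<in> Omega_SA" and y: "\<And>i. i \<ge> n \<Longrightarrow> coeff y i = 0"
  shows "norm (proj (f n) (the (T y)) - the (T y)) \<le> off_norm f T n * norm y"
    and "0 \<le> off_norm f T n"
proof -
  let ?F = "\<lambda>x. proj (f n) (the (T (proj n x))) - the (T (proj n x))"
  define w where "w j = proj (f n) (the (T (basis j))) - the (T (basis j))" for j
  have "bounded_linear (\<lambda>x. \<Sum>j<n. coeff x j *\<^sub>C w j)"
  proof (rule bounded_linear_sum)
    show "bounded_linear (\<lambda>x. coeff x j *\<^sub>C w j)" for j
    proof (rule bounded_linear_intro[of _ "norm (w j)"])
      show "norm (coeff x j *\<^sub>C w j) \<le> norm x * norm (w j)" for x
        by (simp add: mult_right_mono cmod_coeff_le)
    qed (auto intro!: ell2_eqI simp: algebra_simps)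
  qed
  moreover have "(\<Sum>j<n. coeff x j *\<^sub>C w j) = ?F x" for x
  proof -
    have T_proj: "the (T (proj n x)) = (\<Sum>j<n. coeff x j *\<^sub>C the (T (basis j)))"
      using Omega_SA_finite_support(2)[OF T, of n "proj n x"] by simp
    show ?thesis
      unfolding T_proj by (rule ell2_eqI) (auto simp: w_def algebra_simps sum_subtractf sum_negf)
  qed
  ultimately have bl: "bounded_linear ?F" by simp
  have "proj n y = y" by (rule ell2_eqI) (use y in auto)
  then show "norm (proj (f n) (the (T y)) - the (T y)) \<le> off_norm f T n * norm y"
    using onorm[OF bl, of y] by (simp add: off_norm_def)
  show "0 \<le> off_norm f T n"
    unfolding off_norm_def by (rule onorm_pos_le[OF bl])
qed

lemma tolerance_pos: "n \<ge> 1 \<Longrightarrow> tolerance \<alpha> \<beta> n > 0"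
  by (simp add: tolerance_def)

lemma tolerance_tendsto_0:
  assumes "\<alpha> \<longlonglongrightarrow> 0" "\<beta> \<longlonglongrightarrow> 0"
  shows "tolerance \<alpha> \<beta> \<longlonglongrightarrow> 0"
proof (rule Lim_null_comparison)
  show "\<forall>\<^sub>F n in sequentially. norm (tolerance \<alpha> \<beta> n) \<le> \<bar>\<alpha> n + \<beta> n\<bar> + inverse (real n)"
    by (rule always_eventually) (auto simp: tolerance_def field_simps)
  have "(\<lambda>n. \<bar>\<alpha> n + \<beta> n\<bar> + inverse (real n)) \<longlonglongrightarrow> \<bar>0 + 0\<bar> + 0"
    by (intro tendsto_intros assms lim_inverse_n)
  then show "(\<lambda>n. \<bar>\<alpha> n + \<beta> n\<bar> + inverse (real n)) \<longlonglongrightarrow> 0" by simp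
qed

text \<open>
  Three parts of the residual are to be bounded by multiples of the tolerance \<open>\<tau>\<close>. The projected part is
  in the defect. The column tail \<open>off_norm f T k * \<parallel>y\<parallel>\<close> is at most \<open>c1 * \<alpha> k * \<parallel>y\<parallel> \<le> c1 * \<tau>\<close> for large \<open>k\<close>; for
  the finitely many others the summand \<open>\<parallel>y\<parallel>\<^sup>2 / k\<close> of the defect bounds \<open>\<parallel>y\<parallel>\<close> by \<open>k * \<tau>\<close>. The tail of \<open>x\<close> is at
  most \<open>c2 * \<beta> k \<le> c2 * \<tau>\<close> for large \<open>k\<close>; for small \<open>k\<close> only finitely many \<open>n \<le> k\<close> occur, each with a positive
  tolerance. None of these constants involves \<open>z\<close>.
\<close>

lemma residual_le_tolerance:
  assumes f: "\<forall>n\<ge>1. f n > n" and Tx: "(T, x) \<in> Omega f \<alpha> \<beta>"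
  shows "\<exists>C. \<forall>z n k. 1 \<le> n \<and> n \<le> k \<and> defect f \<alpha> \<beta> T x z k \<le> (tolerance \<alpha> \<beta> n)\<^sup>2 \<longrightarrow>
    norm (the (T (candidate_vector k)) - z *\<^sub>C candidate_vector k - x) \<le> C * tolerance \<alpha> \<beta> n"
proof -
  have T: "T \<in> Omega_SA" and offO: "off_norm f T \<in> O(\<alpha>)" and xO: "(\<lambda>n. norm (proj n x - x)) \<in> O(\<beta>)"
    using Tx by (auto simp: Omega_def)
  note off_nonneg = off_norm_bound(2)[OF T, where y = 0 and f = f, simplified]
  obtain c1 where c1_pos: "c1 > 0"
    and "\<forall>\<^sub>F k in sequentially. norm (off_norm f T k) \<le> c1 * norm (\<alpha> k)"
    using offO by (elim landau_o.bigE) (auto simp: norm_mult)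
  then obtain N1 where N1: "\<And>k. k \<ge> N1 \<Longrightarrow> off_norm f T k \<le> c1 * \<bar>\<alpha> k\<bar>"
    by (auto simp: eventually_sequentially dest: abs_le_D1)
  note c1 = c1_pos N1
  obtain c2 where c2_pos: "c2 > 0"
    and "\<forall>\<^sub>F k in sequentially. norm (norm (proj k x - x)) \<le> c2 * norm (\<beta> k)"
    using xO by (elim landau_o.bigE) (auto simp: norm_mult)
  then obtain N2 where N2: "\<And>k. k \<ge> N2 \<Longrightarrow> norm (proj k x - x) \<le> c2 * \<bar>\<beta> k\<bar>"
    by (auto simp: eventually_sequentially dest: abs_le_D1)
  note c2 = c2_pos N2
  define M where "M = (\<Sum>k<N1. off_norm f T k)"
  \<comment> \<open>\<open>S\<close> times the tolerance is at least \<open>\<parallel>x\<parallel>\<close> for every positive \<open>n < N2\<close>\<close>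
  define S where "S = (\<Sum>n\<in>{1..<N2}. norm x / tolerance \<alpha> \<beta> n)"
  have M0: "M \<ge> 0" unfolding M_def by (intro sum_nonneg off_nonneg)
  have S0: "S \<ge> 0" unfolding S_def
    by (intro sum_nonneg divide_nonneg_nonneg) (auto simp: less_imp_le[OF tolerance_pos])
  show ?thesis
  proof (intro exI[of _ "1 + (c1 + M * real N1) + (c2 + S)"] allI impI)
    fix z n k
    assume A: "1 \<le> n \<and> n \<le> k \<and> defect f \<alpha> \<beta> T x z k \<le> (tolerance \<alpha> \<beta> n)\<^sup>2"
    define \<tau> where "\<tau> = tolerance \<alpha> \<beta> n"
    define u where "u = candidate_vector k"
    define r where "r = the (T u) - z *\<^sub>C u - x"
    have \<tau>: "\<tau> > 0" using A by (simp add: \<tau>_def tolerance_pos)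
    have k: "k \<ge> 1" "k < f k" using A f by auto
    have D: "(\<beta> k)\<^sup>2 + ((\<alpha> k * norm u)\<^sup>2 + (norm u)\<^sup>2 / real k) + (norm (proj (f k) r))\<^sup>2 \<le> \<tau>\<^sup>2"
      using A defect_eq[where f = f and k = k and \<alpha> = \<alpha> and \<beta> = \<beta> and x = x and z = z, OF T k(2)]
      by (simp add: u_def r_def \<tau>_def algebra_simps power_mult_distrib)
    have nn: "(\<beta> k)\<^sup>2 \<ge> 0" "(\<alpha> k * norm u)\<^sup>2 \<ge> 0" "(norm u)\<^sup>2 / real k \<ge> 0" "(norm (proj (f k) r))\<^sup>2 \<ge> 0"
      by simp_all
    have sq: "(norm (proj (f k) r))\<^sup>2 \<le> \<tau>\<^sup>2" "(\<beta> k)\<^sup>2 \<le> \<tau>\<^sup>2" "(\<alpha> k * norm u)\<^sup>2 \<le> \<tau>\<^sup>2"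
      using D nn by linarith+
    have Dr: "norm (proj (f k) r) \<le> \<tau>" and D\<beta>: "\<bar>\<beta> k\<bar> \<le> \<tau>" and D\<alpha>: "\<bar>\<alpha> k * norm u\<bar> \<le> \<tau>"
      using power2_le_imp_le[OF sq(1)] sq(2,3) \<tau> by (simp_all add: power2_le_iff_abs_le)
    have Du: "norm u \<le> real k * \<tau>"
    proof (rule power2_le_imp_le)
      have "(norm u)\<^sup>2 / real k \<le> \<tau>\<^sup>2" using D nn by linarith
      then have "(norm u)\<^sup>2 \<le> real k * \<tau>\<^sup>2" using k(1) by (simp add: field_simps)
      also have "\<dots> \<le> (real k)\<^sup>2 * \<tau>\<^sup>2"
        using k(1) by (intro mult_right_mono) (simp_all add: power2_eq_square)
      finally show "(norm u)\<^sup>2 \<le> (real k * \<tau>)\<^sup>2" by (simp add: power_mult_distrib)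
    qed (use \<tau> in simp)
    have off: "off_norm f T k * norm u \<le> (c1 + M * real N1) * \<tau>"
    proof (cases "k \<ge> N1")
      case True
      have "off_norm f T k * norm u \<le> c1 * \<bar>\<alpha> k\<bar> * norm u"
        using c1(2)[OF True] by (rule mult_right_mono) simp
      also have "\<dots> = c1 * \<bar>\<alpha> k * norm u\<bar>" by (simp add: abs_mult)
      also have "\<dots> \<le> c1 * \<tau>" using D\<alpha> c1(1) by (intro mult_left_mono) auto
      also have "\<dots> \<le> (c1 + M * real N1) * \<tau>" using M0 \<tau> by (intro mult_right_mono) auto
      finally show ?thesis .
    next
      case False
      have "off_norm f T k \<le> M"
        unfolding M_def by (rule member_le_sum) (use False off_nonneg in auto)
      then have "off_norm f T k * norm u \<le> M * (real N1 * \<tau>)"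
        using False \<tau> M0 by (intro mult_mono order.trans[OF Du]) auto
      also have "\<dots> \<le> (c1 + M * real N1) * \<tau>"
        using c1(1) \<tau> by (simp add: algebra_simps)
      finally show ?thesis .
    qed
    have tail: "norm (proj k x - x) \<le> (c2 + S) * \<tau>"
    proof (cases "k \<ge> N2")
      case True
      have "norm (proj k x - x) \<le> c2 * \<tau>"
        using c2(2)[OF True] D\<beta> c2(1) by (meson mult_left_mono less_imp_le order.trans)
      also have "\<dots> \<le> (c2 + S) * \<tau>" using S0 \<tau> by (intro mult_right_mono) auto
      finally show ?thesis .
    next
      case False
      have "norm (proj k x - x) \<le> norm x" by (rule norm_ell2_mono) auto
      also have "\<dots> = norm x / tolerance \<alpha> \<beta> n * \<tau>" using \<tau> by (simp add: \<tau>_def)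
      also have "norm x / tolerance \<alpha> \<beta> n \<le> S"
        unfolding S_def using A False
        by (intro member_le_sum) (auto intro!: divide_nonneg_nonneg simp: less_imp_le[OF tolerance_pos])
      also have "S * \<tau> \<le> (c2 + S) * \<tau>" using c2(1) \<tau> by (intro mult_right_mono) auto
      finally show ?thesis using \<tau> by (simp add: mult_right_mono)
    qed
    have "proj (f k) r - r = (proj (f k) (the (T u)) - the (T u)) - (proj (f k) x - x)"
      by (rule ell2_eqI) (use k in \<open>auto simp: r_def u_def candidate_coeff_eq_0\<close>)
    then have "norm (proj (f k) r - r) \<le> norm (proj (f k) (the (T u)) - the (T u)) + norm (proj (f k) x - x)"
      by (metis norm_triangle_ineq4)
    also have "\<dots> \<le> (c1 + M * real N1) * \<tau> + (c2 + S) * \<tau>"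
      using off_norm_bound(1)[OF T, of k u f] off tail norm_proj_tail_antimono[of k "f k" x] k(2)
      by (force simp: u_def candidate_coeff_eq_0)
    finally have "norm (proj (f k) r - r) \<le> (c1 + M * real N1) * \<tau> + (c2 + S) * \<tau>" .
    moreover have "norm r \<le> norm (proj (f k) r) + norm (proj (f k) r - r)"
      by (metis norm_minus_commute norm_triangle_sub)
    ultimately have "norm r \<le> (1 + (c1 + M * real N1) + (c2 + S)) * \<tau>"
      using Dr by (simp add: algebra_simps)
    then show "norm (the (T (candidate_vector k)) - z *\<^sub>C candidate_vector k - x)
        \<le> (1 + (c1 + M * real N1) + (c2 + S)) * tolerance \<alpha> \<beta> n"
      by (simp only: r_def u_def \<tau>_def)
  qed
qed

text \<open>
  A vector from the core with residual below \<open>\<tau>\<close> is approximated by a candidate \<open>u\<close> with the same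
  property. Along the infinitely many numbers of \<open>u\<close> the other summands of the defect tend to 0.
\<close>

lemma ex_small_defect:
  assumes f: "\<forall>n\<ge>1. f n > n" and \<alpha>: "\<alpha> \<longlonglongrightarrow> 0" and \<beta>: "\<beta> \<longlonglongrightarrow> 0"
    and T: "T \<in> Omega_SA" and z: "Im z \<noteq> 0" and \<tau>: "\<tau> > 0"
  shows "\<exists>k\<ge>n. defect f \<alpha> \<beta> T x z k \<le> \<tau>\<^sup>2"
proof -
  have sa: "self_adjoint T" and core: "is_core (ell2.span (range basis)) T"
    using T by (auto simp: Omega_SA_def)
  obtain y where y: "y \<in> ell2.span (range basis)" "norm (the (T y) - z *\<^sub>C y - x) < \<tau>"
    using core_dense_range[OF sa core z \<tau>] by blast
  have "ell2.span (range basis) \<subseteq> {y. \<exists>L. \<forall>i\<ge>L. coeff y i = 0}"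
  proof (rule ell2.span_minimal)
    have "\<forall>i\<ge>Suc j. coeff (basis j) i = 0" for j by simp
    then show "range basis \<subseteq> {y. \<exists>L. \<forall>i\<ge>L. coeff y i = 0}" by blast
    show "ell2.subspace {y. \<exists>L. \<forall>i\<ge>L. coeff y i = 0}"
    proof (rule ell2.subspaceI)
      fix a b assume "a \<in> {y. \<exists>L. \<forall>i\<ge>L. coeff y i = 0}" "b \<in> {y. \<exists>L. \<forall>i\<ge>L. coeff y i = 0}"
      then obtain La Lb where "\<forall>i\<ge>La. coeff a i = 0" "\<forall>i\<ge>Lb. coeff b i = 0" by blast
      then show "a + b \<in> {y. \<exists>L. \<forall>i\<ge>L. coeff y i = 0}"
        by (auto intro!: exI[of _ "max La Lb"])
    qed auto
  qed
  then obtain L where L: "\<And>i. i \<ge> L \<Longrightarrow> coeff y i = 0" using y(1) by blast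
  define g where "g j = the (T (basis j)) - z *\<^sub>C basis j" for j
  have image: "the (T v) - z *\<^sub>C v = (\<Sum>j<L. coeff v j *\<^sub>C g j)" if v: "\<And>i. i \<ge> L \<Longrightarrow> coeff v i = 0" for v
  proof -
    have "the (T v) - z *\<^sub>C v
        = (\<Sum>j<L. coeff v j *\<^sub>C the (T (basis j))) - z *\<^sub>C (\<Sum>j<L. coeff v j *\<^sub>C basis j)"
      using Omega_SA_finite_support(2)[OF T v] finite_support_expansion[OF v] by simp
    also have "\<dots> = (\<Sum>j<L. coeff v j *\<^sub>C g j)"
      by (rule ell2_eqI) (simp add: g_def sum_distrib_left sum_subtractf algebra_simps)
    finally show ?thesis .
  qed
  define G where "G = 1 + (\<Sum>j<L. norm (g j))"
  have G: "G > 0" unfolding G_def by (simp add: add_pos_nonneg sum_nonneg)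
  \<comment> \<open>coefficients that are off by less than \<open>\<epsilon>\<close> change the image by less than \<open>\<epsilon> * G\<close>, the room left below \<open>\<tau>\<close>\<close>
  define \<epsilon> where "\<epsilon> = (\<tau> - norm (the (T y) - z *\<^sub>C y - x)) / G"
  have \<epsilon>: "\<epsilon> > 0" using y(2) G by (simp add: \<epsilon>_def)
  obtain u where inf: "\<And>N. \<exists>k\<ge>N. candidate_vector k = u" and u0: "\<And>i. i \<ge> L \<Longrightarrow> coeff u i = 0"
    and near: "\<And>i. i < L \<Longrightarrow> cmod (coeff u i - coeff y i) < \<epsilon>"
    using candidates_dense[OF \<epsilon>, of L "coeff y"] by blast
  define r where "r = the (T u) - z *\<^sub>C u - x"
  have u_image: "the (T u) - z *\<^sub>C u = (\<Sum>j<L. coeff u j *\<^sub>C g j)"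
    by (rule image) (rule u0)
  have y_image: "the (T y) - z *\<^sub>C y = (\<Sum>j<L. coeff y j *\<^sub>C g j)"
    by (rule image) (rule L)
  have difference: "r - (the (T y) - z *\<^sub>C y - x) = (\<Sum>j<L. (coeff u j - coeff y j) *\<^sub>C g j)"
    unfolding r_def u_image y_image
    by (rule ell2_eqI) (simp add: sum_subtractf algebra_simps)
  have "norm (r - (the (T y) - z *\<^sub>C y - x)) \<le> (\<Sum>j<L. norm ((coeff u j - coeff y j) *\<^sub>C g j))"
    unfolding difference by (rule norm_sum)
  also have "\<dots> \<le> (\<Sum>j<L. \<epsilon> * norm (g j))"
    using near by (intro sum_mono) (auto intro!: mult_right_mono simp: less_imp_le)
  also have "\<dots> < \<epsilon> * G" using \<epsilon> by (simp add: G_def sum_distrib_left algebra_simps)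
  also have "\<epsilon> * G = \<tau> - norm (the (T y) - z *\<^sub>C y - x)" using G by (simp add: \<epsilon>_def)
  finally have "norm r < \<tau>"
    using norm_triangle_sub[of r "the (T y) - z *\<^sub>C y - x"] by linarith
  then have r\<tau>: "(norm r)\<^sup>2 < \<tau>\<^sup>2" by (simp add: power_strict_mono)
  have "(\<lambda>k. (\<beta> k)\<^sup>2 + ((\<alpha> k)\<^sup>2 + inverse (real k)) * (norm u)\<^sup>2 + (norm r)\<^sup>2)
      \<longlonglongrightarrow> 0\<^sup>2 + (0\<^sup>2 + 0) * (norm u)\<^sup>2 + (norm r)\<^sup>2"
    by (intro tendsto_intros \<alpha> \<beta> lim_inverse_n)
  then have "\<forall>\<^sub>F k in sequentially. (\<beta> k)\<^sup>2 + ((\<alpha> k)\<^sup>2 + inverse (real k)) * (norm u)\<^sup>2 + (norm r)\<^sup>2 < \<tau>\<^sup>2"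
    by (rule order_tendstoD) (use r\<tau> in simp)
  then obtain N where N: "\<And>k. k \<ge> N \<Longrightarrow>
      (\<beta> k)\<^sup>2 + ((\<alpha> k)\<^sup>2 + inverse (real k)) * (norm u)\<^sup>2 + (norm r)\<^sup>2 < \<tau>\<^sup>2"
    by (auto simp: eventually_sequentially)
  obtain k where k: "k \<ge> max 1 (max n N)" "candidate_vector k = u" using inf by blast
  have "defect f \<alpha> \<beta> T x z k = (\<beta> k)\<^sup>2 + ((\<alpha> k)\<^sup>2 + inverse (real k)) * (norm u)\<^sup>2 + (norm (proj (f k) r))\<^sup>2"
    using defect_eq[OF T, of k f \<alpha> \<beta> x z] k f by (simp add: r_def inverse_eq_divide)
  also have "\<dots> \<le> (\<beta> k)\<^sup>2 + ((\<alpha> k)\<^sup>2 + inverse (real k)) * (norm u)\<^sup>2 + (norm r)\<^sup>2"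
    by (simp add: norm_proj_le power_mono)
  also have "\<dots> \<le> \<tau>\<^sup>2" using N[of k] k(1) by simp
  finally show ?thesis using k(1) by auto
qed


theorem corollary2p2:
  fixes f :: "nat \<Rightarrow> nat" and \<alpha> \<beta> :: "nat \<Rightarrow> real"
  assumes "\<forall>n\<ge>1. f n > n"
    and "\<forall>n\<ge>1. \<alpha> n \<ge> 0" and "\<alpha> \<longlonglongrightarrow> 0"
    and "\<forall>n\<ge>1. \<beta> n \<ge> 0" and "\<beta> \<longlonglongrightarrow> 0"
  shows "\<exists>\<Gamma> :: nat \<Rightarrow> (operator \<times> ell2) \<times> complex \<Rightarrow> ell2.
    arithmetic_algorithms (Omega f \<alpha> \<beta> \<times> (UNIV - \<real>)) (evaluation f \<alpha> \<beta>) finite_vector \<Gamma> \<and>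
    (\<forall>(T, x) \<in> Omega f \<alpha> \<beta>. \<forall>z \<in> UNIV - \<real>.
       (\<forall>n\<ge>1. finite {k. cinner (\<Gamma> n ((T, x), z)) (basis k) \<noteq> 0}) \<and>
       (\<lambda>n. \<Gamma> n ((T, x), z)) \<longlonglongrightarrow> resolvent z T x) \<and>
    (\<forall>(T, x) \<in> Omega f \<alpha> \<beta>. \<exists>C :: real. \<forall>z \<in> UNIV - \<real>. \<forall>n\<ge>1. \<alpha> n + \<beta> n > 0 \<longrightarrow>
       norm (\<Gamma> n ((T, x), z) - resolvent z T x) \<le> C / \<bar>Im z\<bar> * (\<alpha> n + \<beta> n))"
proof -
  define orc where "orc A = (\<lambda>q i j. evaluation f \<alpha> \<beta> q i j A)" for A
  define \<Gamma> where "\<Gamma> n A = finite_vector (THE out. bss_computes machine (orc A) n out)" for n A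
  have run: "\<exists>k\<ge>n. defect f \<alpha> \<beta> T x z k \<le> (tolerance \<alpha> \<beta> n)\<^sup>2 \<and>
      bss_computes machine (orc ((T, x), z)) n (candidate_list k) \<and> \<Gamma> n ((T, x), z) = candidate_vector k"
    if n: "n \<ge> 1" and T: "T \<in> Omega_SA" and z: "z \<notin> \<real>" for n T x z
  proof -
    have "Im z \<noteq> 0" using z by (simp add: complex_is_Real_iff)
    then obtain K where K: "K \<ge> n" "defect f \<alpha> \<beta> T x z K \<le> (tolerance \<alpha> \<beta> n)\<^sup>2"
      using ex_small_defect[OF assms(1,3,5) T _ tolerance_pos[OF n], of z n x] by blast
    interpret resolvent_search f \<alpha> \<beta> T x z n
      by unfold_locales (use assms(1) n in auto)
    obtain k where k: "k \<ge> n" "defect f \<alpha> \<beta> T x z k \<le> (tolerance \<alpha> \<beta> n)\<^sup>2"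
      "bss_computes machine (orc ((T, x), z)) n (candidate_list k)"
      using machine_correct[OF K] unfolding orc_def by blast
    moreover have "\<Gamma> n ((T, x), z) = candidate_vector k"
      using the_equality[of "bss_computes machine (orc ((T, x), z)) n", OF k(3) bss_computes_unique[OF _ k(3)]]
      by (simp add: \<Gamma>_def candidate_vector_def)
    ultimately show ?thesis by blast
  qed
  have SA: "T \<in> Omega_SA" if "(T, x) \<in> Omega f \<alpha> \<beta>" for T x
    using that by (auto simp: Omega_def)
  have arith: "arithmetic_algorithms (Omega f \<alpha> \<beta> \<times> (UNIV - \<real>)) (evaluation f \<alpha> \<beta>) finite_vector \<Gamma>"
  proof (rule arithmetic_algorithmsI[OF machine_def[unfolded Let_def]])
    fix n and A :: "(operator \<times> ell2) \<times> complex"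
    assume "n \<ge> (1 :: nat)" "A \<in> Omega f \<alpha> \<beta> \<times> (UNIV - \<real>)"
    moreover obtain T x z where "A = ((T, x), z)" by (metis prod.exhaust)
    ultimately show "\<exists>out. bss_computes machine (\<lambda>q i j. evaluation f \<alpha> \<beta> q i j A) n out \<and> \<Gamma> n A = finite_vector out"
      using run[of n T z x] SA[of T x] by (auto simp: orc_def candidate_vector_def)
  qed
  have error: "\<exists>C. \<forall>z\<in>UNIV - \<real>. \<forall>n\<ge>1.
      norm (\<Gamma> n ((T, x), z) - resolvent z T x) \<le> C / \<bar>Im z\<bar> * tolerance \<alpha> \<beta> n"
    if Tx: "(T, x) \<in> Omega f \<alpha> \<beta>" for T x
  proof -
    obtain C where C: "\<And>z n k. 1 \<le> n \<and> n \<le> k \<and> defect f \<alpha> \<beta> T x z k \<le> (tolerance \<alpha> \<beta> n)\<^sup>2 \<Longrightarrow>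
      norm (the (T (candidate_vector k)) - z *\<^sub>C candidate_vector k - x) \<le> C * tolerance \<alpha> \<beta> n"
      using residual_le_tolerance[OF assms(1) Tx] by blast
    have "norm (\<Gamma> n ((T, x), z) - resolvent z T x) \<le> C / \<bar>Im z\<bar> * tolerance \<alpha> \<beta> n"
      if z: "z \<in> UNIV - \<real>" and n: "n \<ge> 1" for z n
    proof -
      have Im: "Im z \<noteq> 0" using z by (simp add: complex_is_Real_iff)
      obtain k where k: "k \<ge> n" "defect f \<alpha> \<beta> T x z k \<le> (tolerance \<alpha> \<beta> n)\<^sup>2"
        "\<Gamma> n ((T, x), z) = candidate_vector k"
        using run[OF n SA[OF Tx], of z x] z by blast
      have "candidate_vector k \<in> dom T"
        by (rule Omega_SA_finite_support(1)[OF SA[OF Tx], of k]) (simp add: candidate_coeff_eq_0)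
      then have "norm (candidate_vector k - resolvent z T x)
          \<le> norm (the (T (candidate_vector k)) - z *\<^sub>C candidate_vector k - x) / \<bar>Im z\<bar>"
        using SA[OF Tx] Im by (intro resolvent_error_le) (auto simp: Omega_SA_def)
      also have "\<dots> \<le> C * tolerance \<alpha> \<beta> n / \<bar>Im z\<bar>"
        using C[of n k z] n k by (intro divide_right_mono) auto
      finally show ?thesis by (simp add: k(3))
    qed
    then show ?thesis by blast
  qed
  have conv: "(\<lambda>n. \<Gamma> n ((T, x), z)) \<longlonglongrightarrow> resolvent z T x"
    if Tx: "(T, x) \<in> Omega f \<alpha> \<beta>" and z: "z \<in> UNIV - \<real>" for T x z
  proof -
    obtain C where C: "\<And>n. n \<ge> 1 \<Longrightarrow>
      norm (\<Gamma> n ((T, x), z) - resolvent z T x) \<le> C / \<bar>Im z\<bar> * tolerance \<alpha> \<beta> n"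
      using error[OF Tx] z by blast
    have "(\<lambda>n. \<Gamma> n ((T, x), z) - resolvent z T x) \<longlonglongrightarrow> 0"
    proof (rule Lim_null_comparison)
      show "\<forall>\<^sub>F n in sequentially. norm (\<Gamma> n ((T, x), z) - resolvent z T x) \<le> C / \<bar>Im z\<bar> * tolerance \<alpha> \<beta> n"
        using eventually_ge_at_top[of 1] by (rule eventually_mono) (rule C)
      show "(\<lambda>n. C / \<bar>Im z\<bar> * tolerance \<alpha> \<beta> n) \<longlonglongrightarrow> 0"
        by (rule tendsto_mult_right_zero[OF tolerance_tendsto_0[OF assms(3,5)]])
    qed
    then show ?thesis by (simp add: LIM_zero_iff)
  qed
  have finite_support: "finite {k. cinner (\<Gamma> n ((T, x), z)) (basis k) \<noteq> 0}" for n T x z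
    by (rule finite_subset[of _ "{..<length (THE out. bss_computes machine (orc ((T, x), z)) n out)}"])
      (auto simp: \<Gamma>_def split: if_splits)
  show ?thesis
  proof (intro exI[of _ \<Gamma>] conjI ballI allI impI; clarify?)
    fix T x assume Tx: "(T, x) \<in> Omega f \<alpha> \<beta>"
    then obtain C where C: "\<forall>z\<in>UNIV - \<real>. \<forall>n\<ge>1.
        norm (\<Gamma> n ((T, x), z) - resolvent z T x) \<le> C / \<bar>Im z\<bar> * tolerance \<alpha> \<beta> n"
      using error by blast
    then show "\<exists>C. \<forall>z\<in>UNIV - \<real>. \<forall>n\<ge>1. \<alpha> n + \<beta> n > 0 \<longrightarrow>
        norm (\<Gamma> n ((T, x), z) - resolvent z T x) \<le> C / \<bar>Im z\<bar> * (\<alpha> n + \<beta> n)"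
      by (intro exI[of _ C]) (auto simp: tolerance_def split: if_splits)
  qed (use arith conv finite_support in auto)
qed

end
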